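(* Every $n$-vertex graph has at most $F(n+1)-1$ matching cuts, and the bound is attained by the path on $n$ vertices. Moreover, if $n\ge 5$, an $n$-vertex graph $G$ has exactly $F(n+1)-1$ matching cuts if and only if $G$ is a path. Furthermore, all matching cuts of an $n$-vertex graph can be enumerated in $\mathcal O^*(F(n))$ time.
   Context: $F(n)$ is the $n$-th Fibonacci number ($F(1)=F(2)=1$, $F(n)=F(n-1)+F(n-2)$); note $F(n)=\mathcal O(1.6181^n)$. Graphs are finite, simple, undirected. A matching cut of $G$ is a (possibly empty) set of edges $M$ that is a matching and equals $E(A,B)$, the set of edges between $A$ and $B$, for some partition $\{A,B\}$ of $V(G)$ into two nonempty sets; a matching cut is counted as an edge set (so, e.g., an edgeless graph on at least two vertices has exactly one matching cut, the empty set). $\mathcal O^*$ suppresses factors polynomial in $n$. *)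

theory Defs
  imports Complex_Main "HOL-Number_Theory.Fib" "HOL-Library.Landau_Symbols"
begin

definition simple_graph :: "'a set \<Rightarrow> 'a set set \<Rightarrow> bool" where
  "simple_graph V E \<longleftrightarrow> finite V \<and> E \<subseteq> {e. e \<subseteq> V \<and> card e = 2}"

definition matching :: "'a set set \<Rightarrow> 'a set set \<Rightarrow> bool" where
  "matching E M \<longleftrightarrow> M \<subseteq> E \<and> pairwise disjnt M"

definition edges_between :: "'a set set \<Rightarrow> 'a set \<Rightarrow> 'a set \<Rightarrow> 'a set set" where
  "edges_between E A B = {e \<in> E. \<exists>a\<in>A. \<exists>b\<in>B. e = {a, b}}"

definition matching_cut :: "'a set \<Rightarrow> 'a set set \<Rightarrow> 'a set set \<Rightarrow> bool" where
  "matching_cut V E M \<longleftrightarrow> matching E M \<and>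
     (\<exists>A B. A \<noteq> {} \<and> B \<noteq> {} \<and> A \<inter> B = {} \<and> A \<union> B = V \<and> M = edges_between E A B)"

definition matching_cuts :: "'a set \<Rightarrow> 'a set set \<Rightarrow> 'a set set set" where
  "matching_cuts V E = {M. matching_cut V E M}"

text \<open>The path on \<open>n\<close> vertices has vertex set \<open>{..<n}\<close>.\<close>

definition path_edges :: "nat \<Rightarrow> nat set set" where
  "path_edges n = {{i, Suc i} | i. Suc i < n}"

definition graph_iso :: "'a set \<Rightarrow> 'a set set \<Rightarrow> 'b set \<Rightarrow> 'b set set \<Rightarrow> bool" where
  "graph_iso V E W F \<longleftrightarrow>
     (\<exists>f. bij_betw f V W \<and> (\<forall>u\<in>V. \<forall>v\<in>V. {u, v} \<in> E \<longleftrightarrow> {f u, f v} \<in> F))"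

definition is_path :: "'a set \<Rightarrow> 'a set set \<Rightarrow> bool" where
  "is_path V E \<longleftrightarrow> (\<exists>n\<ge>1. graph_iso {..<n} (path_edges n) V E)"

text \<open>
  Running times refer to a successor RAM with structured control flow. It has registers and
  arrays of natural numbers and an output tape that can only be appended to; every
  instruction and every evaluation of a test costs one step. Numbers can only be copied,
  compared, incremented and decremented, hence a run of \<open>t\<close> steps creates no number exceeding
  its inputs and its program constants by more than \<open>t\<close> (lemma \<open>exec_growth\<close> below). So in
  time \<open>2 ^ O(n)\<close> all numbers have \<open>O(n)\<close> bits, and charging for bit operations
  instead would change running times by a factor polynomial in \<open>n\<close> only.
\<close>

datatype test = Less nat nat | Equal nat nat

datatype com =
    Skip
  | Const nat nat
  | Move nat nat
  | Inc nat
  | Dec nat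
  | Read nat nat nat
  | Write nat nat nat
  | Out nat
  | Seq com com
  | Cond test com com
  | While test com

record state =
  reg :: "nat \<Rightarrow> nat"
  arr :: "nat \<Rightarrow> nat \<Rightarrow> nat"
  out :: "nat list"

fun holds :: "test \<Rightarrow> state \<Rightarrow> bool" where
  "holds (Less x y) s \<longleftrightarrow> reg s x < reg s y"
| "holds (Equal x y) s \<longleftrightarrow> reg s x = reg s y"

abbreviation set_reg :: "nat \<Rightarrow> nat \<Rightarrow> state \<Rightarrow> state" where
  "set_reg x v s \<equiv> s\<lparr>reg := (reg s)(x := v)\<rparr>"

abbreviation set_arr :: "nat \<Rightarrow> nat \<Rightarrow> nat \<Rightarrow> state \<Rightarrow> state" where
  "set_arr a i v s \<equiv> s\<lparr>arr := (arr s)(a := (arr s a)(i := v))\<rparr>"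

text \<open>\<open>exec c s t s'\<close>: program \<open>c\<close> started in \<open>s\<close> halts in \<open>s'\<close> after exactly \<open>t\<close> steps.\<close>

inductive exec :: "com \<Rightarrow> state \<Rightarrow> nat \<Rightarrow> state \<Rightarrow> bool" where
  Skip: "exec Skip s 1 s"
| Const: "exec (Const x k) s 1 (set_reg x k s)"
| Move: "exec (Move x y) s 1 (set_reg x (reg s y) s)"
| Inc: "exec (Inc x) s 1 (set_reg x (reg s x + 1) s)"
| Dec: "exec (Dec x) s 1 (set_reg x (reg s x - 1) s)"
| Read: "exec (Read x a i) s 1 (set_reg x (arr s a (reg s i)) s)"
| Write: "exec (Write a i x) s 1 (set_arr a (reg s i) (reg s x) s)"
| Out: "exec (Out x) s 1 (s\<lparr>out := out s @ [reg s x]\<rparr>)"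
| Seq: "exec c s t s' \<Longrightarrow> exec d s' u s'' \<Longrightarrow> exec (Seq c d) s (t + u) s''"
| Cond_True: "holds b s \<Longrightarrow> exec c s t s' \<Longrightarrow> exec (Cond b c d) s (1 + t) s'"
| Cond_False: "\<not> holds b s \<Longrightarrow> exec d s t s' \<Longrightarrow> exec (Cond b c d) s (1 + t) s'"
| While_False: "\<not> holds b s \<Longrightarrow> exec (While b c) s 1 s"
| While_True: "holds b s \<Longrightarrow> exec c s t s' \<Longrightarrow> exec (While b c) s' u s'' \<Longrightarrow>
    exec (While b c) s (1 + t + u) s''"

inductive_cases exec_cases:
  "exec Skip s t s'" "exec (Const x k) s t s'" "exec (Move x y) s t s'" "exec (Inc x) s t s'"
  "exec (Dec x) s t s'" "exec (Read x a i) s t s'" "exec (Write a i x) s t s'"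
  "exec (Out x) s t s'" "exec (Seq c d) s t s'" "exec (Cond b c d) s t s'"
  "exec (While b c) s t s'"

lemma exec_deterministic:
  "exec c s t s' \<Longrightarrow> exec c s u s'' \<Longrightarrow> t = u \<and> s' = s''"
proof (induction arbitrary: u s'' rule: exec.induct)
  case (Seq c s t s' d v s2)
  from Seq.prems obtain t1 s1 u1 where
    u: "u = t1 + u1" and 1: "exec c s t1 s1" and 2: "exec d s1 u1 s''"
    by (rule exec_cases)
  have e: "t = t1" "s' = s1" using Seq.IH(1)[OF 1] by blast+
  have "v = u1 \<and> s2 = s''" by (rule Seq.IH(2)) (use 2 e in blast)
  with u e show ?case by blast
next
  case (Cond_True b s c t s' d)
  from Cond_True.prems obtain t1 where "u = 1 + t1" "exec c s t1 s''"
    by (rule exec_cases) (use Cond_True.hyps in auto)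
  with Cond_True.IH[of t1 s''] show ?case by simp
next
  case (Cond_False b s d t s' c)
  from Cond_False.prems obtain t1 where "u = 1 + t1" "exec d s t1 s''"
    by (rule exec_cases) (use Cond_False.hyps in auto)
  with Cond_False.IH[of t1 s''] show ?case by simp
next
  case (While_False b s c)
  from While_False.prems show ?case
    by (rule exec_cases) (use While_False.hyps in auto)
next
  case (While_True b s c t s' v s2)
  from While_True.prems obtain t1 s1 u1 where
    u: "u = 1 + t1 + u1" and 1: "exec c s t1 s1" and 2: "exec (While b c) s1 u1 s''"
    by (rule exec_cases) (use While_True.hyps in auto)
  have e: "t = t1" "s' = s1" using While_True.IH(1)[OF 1] by blast+
  have "v = u1 \<and> s2 = s''" by (rule While_True.IH(2)) (use 2 e in blast)
  with u e show ?case by blast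
qed (erule exec_cases, simp)+

fun consts_le :: "nat \<Rightarrow> com \<Rightarrow> bool" where
  "consts_le K (Const x k) \<longleftrightarrow> k \<le> K"
| "consts_le K (Seq c d) \<longleftrightarrow> consts_le K c \<and> consts_le K d"
| "consts_le K (Cond b c d) \<longleftrightarrow> consts_le K c \<and> consts_le K d"
| "consts_le K (While b c) \<longleftrightarrow> consts_le K c"
| "consts_le K _ \<longleftrightarrow> True"

definition state_le :: "nat \<Rightarrow> state \<Rightarrow> bool" where
  "state_le K s \<longleftrightarrow> (\<forall>x. reg s x \<le> K) \<and> (\<forall>a i. arr s a i \<le> K)"

lemma state_le_mono: "state_le K s \<Longrightarrow> K \<le> L \<Longrightarrow> state_le L s"
  unfolding state_le_def by (meson le_trans)

lemma exec_growth:
  "exec c s t s' \<Longrightarrow> consts_le K c \<Longrightarrow> K \<le> L \<Longrightarrow> state_le L s \<Longrightarrow> state_le (L + t) s'"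
proof (induction arbitrary: L rule: exec.induct)
  case (Seq c s t s' d u s'')
  have "state_le (L + t) s'" using Seq.IH(1) Seq.prems by simp
  then have "state_le (L + t + u) s''" using Seq.IH(2)[of "L + t"] Seq.prems by simp
  then show ?case by (simp add: add.assoc)
next
  case (Cond_True b s c t s' d)
  then have "state_le (L + t) s'" by simp
  then show ?case by (rule state_le_mono) simp
next
  case (Cond_False b s d t s' c)
  then have "state_le (L + t) s'" by simp
  then show ?case by (rule state_le_mono) simp
next
  case (While_True b s c t s' u s'')
  have "state_le (L + t) s'" using While_True.IH(1) While_True.prems by simp
  then have "state_le (L + t + u) s''" using While_True.IH(2)[of "L + t"] While_True.prems by simp
  then show ?case by (rule state_le_mono) simp
next
  case (Const x k s)
  then have "k \<le> L" by simp
  with Const show ?case by (simp add: state_le_def le_Suc_eq)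
next
  case (Dec x s)
  have "reg s x - 1 \<le> Suc L" using Dec by (simp add: state_le_def le_diff_conv le_SucI)
  with Dec show ?case by (simp add: state_le_def le_SucI)
qed (simp_all add: state_le_def le_SucI)

text \<open>
  A graph on \<open>{..<n}\<close> is given to a program by \<open>n\<close> in register 0 and its adjacency matrix,
  row by row, in array 0.
\<close>

definition input_state :: "nat \<Rightarrow> nat set set \<Rightarrow> state" where
  "input_state n E =
     \<lparr>reg = (\<lambda>x. if x = 0 then n else 0),
      arr = (\<lambda>a k. if a = 0 \<and> k < n * n \<and> {k div n, k mod n} \<in> E then 1 else 0),
      out = []\<rparr>"

text \<open>
  An edge set is written as the number of its edges followed by their end vertices, the edges
  being listed in any order without repetition.
\<close>

definition edge_set :: "(nat \<times> nat) list \<Rightarrow> nat set set" where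
  "edge_set es = (\<lambda>(u, v). {u, v}) ` set es"

definition edge_code :: "(nat \<times> nat) list \<Rightarrow> nat list" where
  "edge_code es = length es # concat (map (\<lambda>(u, v). [u, v]) es)"

definition lists_exactly :: "nat list \<Rightarrow> nat set set set \<Rightarrow> bool" where
  "lists_exactly w \<M> \<longleftrightarrow>
     (\<exists>ess. w = concat (map edge_code ess) \<and>
        (\<forall>es\<in>set ess. distinct (map (\<lambda>(u, v). {u, v}) es)) \<and>
        distinct (map edge_set ess) \<and> set (map edge_set ess) = \<M>)"

definition enumerates_matching_cuts_in_time :: "com \<Rightarrow> (nat \<Rightarrow> nat) \<Rightarrow> bool" where
  "enumerates_matching_cuts_in_time P T \<longleftrightarrow>
     (\<forall>n E. simple_graph {..<n} E \<longrightarrow>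
        (\<exists>t s. exec P (input_state n E) t s \<and> t \<le> T n \<and>
               lists_exactly (out s) (matching_cuts {..<n} E)))"

definition O_star :: "(nat \<Rightarrow> real) \<Rightarrow> (nat \<Rightarrow> real) set" where
  "O_star f = {g. \<exists>k. g \<in> O(\<lambda>n. real n ^ k * f n)}"

end

theory Submission
  imports Defs
begin

text \<open>
  Order the vertices such that every vertex is either adjacent to an earlier one, its parent, or
  opens a new component. The parent edges form a spanning forest, and a cut is determined by the
  forest edges it contains, because these determine a two-colouring up to swapping colours on
  components. So there are at most as many matching cuts (the empty set included) as matchings
  of the forest. The last vertex of the order is a leaf of the forest; removing it, alone or
  together with its parent, gives the Fibonacci recursion for the number of matchings. A second
  component makes the bound strict, and for a connected graph the empty set is no cut, which
  accounts for the \<open>- 1\<close>.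

  If equality holds in the recursion throughout, then the parent of the last vertex must be an
  end of the path formed by the other vertices, since otherwise removing it leaves a
  disconnected forest. Hence the graph has a Hamiltonian path; ordered along it, every single
  edge of the path must extend to a matching cut, which excludes chords.

  For the enumeration, run through the matchings of the forest in lexicographic order, colour the
  vertices accordingly, and output the resulting cut if it is a matching. Every prefix of a matching
  extends to a matching, so each step takes polynomial time, and there are at most
  \<open>fib (n + 1)\<close> steps.
\<close>

text \<open>Passing to the forest loses nothing in one direction only. A matching cut is recovered
  from its forest edges, but the cut induced by a forest matching may fail to be a matching because
  of edges outside the forest. So the trace map from cuts to forest matchings is injective and in
  general not onto. Two consequences shape the proof. First, equality in the bound for a connected
  graph says that the trace map is onto, for every search order; this freedom is what allows
  switching to a better order once a Hamiltonian path is known. Second, the enumeration may go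
  through rounds without output, which is harmless since the rounds are bounded by the number of
  forest matchings and not by the number of cuts. For a disconnected graph the empty set is a cut,
  so the \<open>- 1\<close> has to be earned elsewhere. Opening a root only when forced makes
  components intervals of positions, and splitting the positions at a second root \<open>r\<close>
  saves \<open>fib r * fib (n - r)\<close>.\<close>

section \<open>Matchings of a forest given by parents\<close>

text \<open>The edge between \<open>j\<close> and its parent \<open>par j < j\<close> is represented by \<open>j\<close>; a vertex with
  \<open>par j = j\<close> is a root.\<close>

definition forest_matchings :: "(nat \<Rightarrow> nat) \<Rightarrow> nat set \<Rightarrow> nat set set" where
  "forest_matchings par S = {X. X \<subseteq> S \<and> par ` X \<subseteq> S \<and> (\<forall>j\<in>X. par j < j) \<and>
     (\<forall>i\<in>X. \<forall>j\<in>X. i \<noteq> j \<longrightarrow> par i \<noteq> j \<and> par i \<noteq> par j)}"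

lemma forest_matchings_subset_Pow: "forest_matchings par S \<subseteq> Pow S"
  by (auto simp: forest_matchings_def)

lemma finite_forest_matchings: "finite S \<Longrightarrow> finite (forest_matchings par S)"
  by (meson finite_Pow_iff finite_subset forest_matchings_subset_Pow)

lemma forest_matchings_empty [simp]: "forest_matchings par {} = {{}}"
  by (auto simp: forest_matchings_def)

text \<open>The set \<open>S\<close> is arbitrary instead of an initial segment because deleting
  \<open>par v\<close> together with \<open>v\<close> leaves a gap in the positions.\<close>

lemma forest_matchings_Max:
  assumes "finite S" "v \<in> S" "\<And>i. i \<in> S \<Longrightarrow> i \<le> v"
  shows "forest_matchings par S = forest_matchings par (S - {v}) \<union>
    (if par v < v \<and> par v \<in> S then insert v ` forest_matchings par (S - {v, par v}) else {})"
    (is "?L = ?A \<union> ?B")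
proof
  show "?L \<subseteq> ?A \<union> ?B"
  proof
    fix X assume X: "X \<in> ?L"
    show "X \<in> ?A \<union> ?B"
    proof (cases "v \<in> X")
      case False
      moreover have "par j \<noteq> v" if "j \<in> X" for j
        using X that assms(3)[of j] by (auto simp: forest_matchings_def subset_iff)
      ultimately show ?thesis using X by (auto simp: forest_matchings_def)
    next
      case True
      have p: "par v < v" "par v \<in> S" using X True by (auto simp: forest_matchings_def)
      have "par j \<noteq> v" if "j \<in> X" for j
        using X that assms(3)[of j] by (auto simp: forest_matchings_def subset_iff)
      moreover have "par v \<notin> X" using X True p(1) by (force simp: forest_matchings_def)
      ultimately have "X - {v} \<in> forest_matchings par (S - {v, par v})"
        using X True by (auto simp: forest_matchings_def)
      moreover have "X = insert v (X - {v})" using True by blast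
      ultimately have "X \<in> insert v ` forest_matchings par (S - {v, par v})" by (rule rev_image_eqI)
      then show ?thesis using p by simp
    qed
  qed
  show "?A \<union> ?B \<subseteq> ?L"
  proof
    fix X assume "X \<in> ?A \<union> ?B"
    then consider "X \<in> ?A" | Y where "par v < v" "par v \<in> S" "X = insert v Y"
        "Y \<in> forest_matchings par (S - {v, par v})"
      by (auto split: if_splits)
    then show "X \<in> ?L"
      by cases (use assms(2) in \<open>auto simp: forest_matchings_def\<close>)
  qed
qed

lemma card_forest_matchings_Max:
  assumes "finite S" "v \<in> S" "\<And>i. i \<in> S \<Longrightarrow> i \<le> v"
  shows "card (forest_matchings par S) = card (forest_matchings par (S - {v})) +
    (if par v < v \<and> par v \<in> S then card (forest_matchings par (S - {v, par v})) else 0)"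
proof -
  let ?F = "forest_matchings par (S - {v, par v})"
  have "inj_on (insert v) ?F"
    by (rule inj_onI) (auto simp: forest_matchings_def insert_eq_iff)
  then have "card (insert v ` ?F) = card ?F" by (rule card_image)
  moreover have "forest_matchings par (S - {v}) \<inter> insert v ` ?F = {}"
    by (auto simp: forest_matchings_def)
  ultimately show ?thesis
    using assms(1) forest_matchings_Max[of S v par, OF assms]
    by (auto simp: card_Un_disjoint finite_forest_matchings)
qed

lemma card_forest_matchings_le:
  "finite S \<Longrightarrow> card (forest_matchings par S) \<le> fib (card S + 1)"
proof (induction "card S" arbitrary: S rule: less_induct)
  case less
  show ?case
  proof (cases "S = {}")
    case False
    define v where "v = Max S"
    have v: "v \<in> S" "\<And>i. i \<in> S \<Longrightarrow> i \<le> v" using less.prems False by (simp_all add: v_def)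
    have c1: "card (S - {v}) = card S - 1" and p: "card S > 0"
      using v(1) less.prems by (auto simp: card_gt_0_iff)
    have 1: "card (forest_matchings par (S - {v})) \<le> fib (card S)"
      using less.hyps[of "S - {v}"] less.prems c1 p by simp
    show ?thesis
    proof (cases "par v < v \<and> par v \<in> S")
      case True
      then have "card (S - {v, par v}) = card S - 2" "card S \<ge> 2"
        using v(1) less.prems card_mono[of S "{v, par v}"] by (auto simp: card_Diff_subset)
      then have "card (forest_matchings par (S - {v, par v})) \<le> fib (card S - 1)"
        using less.hyps[of "S - {v, par v}"] less.prems by (simp add: Suc_diff_Suc numeral_2_eq_2)
      with 1 True p show ?thesis
        using card_forest_matchings_Max[OF less.prems v, of par]
        by (cases "card S") auto
    next
      case False
      with 1 p show ?thesis
        using card_forest_matchings_Max[OF less.prems v, of par, unfolded if_not_P[OF False]]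
        by (cases "card S") auto
    qed
  qed simp
qed

section \<open>Forests attaining the Fibonacci bound\<close>

definition extremal :: "(nat \<Rightarrow> nat) \<Rightarrow> nat set \<Rightarrow> bool" where
  "extremal par S \<longleftrightarrow> finite S \<and> card (forest_matchings par S) = fib (card S + 1)"

text \<open>With \<open>card S = m + 2\<close> the bound is
  \<open>fib (m + 3) = fib (m + 2) + fib (m + 1)\<close>. The second summand is positive, so
  \<open>v\<close> must have its parent in \<open>S\<close>; and two upper bounds whose sum is
  attained are attained separately.\<close>

lemma extremal_Max:
  assumes "extremal par S" "card S \<ge> 2" "v \<in> S" "\<And>i. i \<in> S \<Longrightarrow> i \<le> v"
  shows "par v < v" "par v \<in> S" "extremal par (S - {v})" "extremal par (S - {v, par v})"
proof -
  have fin: "finite S" and eq: "card (forest_matchings par S) = fib (card S + 1)"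
    using assms(1) by (auto simp: extremal_def)
  obtain m where m: "card S = Suc (Suc m)"
    using assms(2) by (metis add_2_eq_Suc le_add_diff_inverse)
  have c1: "card (S - {v}) = Suc m" using m assms(3) fin by simp
  have 1: "card (forest_matchings par (S - {v})) \<le> fib (Suc (Suc m))"
    using card_forest_matchings_le[of "S - {v}" par] fin c1 by simp
  have p: "par v < v \<and> par v \<in> S"
  proof (rule ccontr)
    assume "\<not> ?thesis"
    then have "card (forest_matchings par S) = card (forest_matchings par (S - {v}))"
      using card_forest_matchings_Max[OF fin assms(3,4)] by auto
    moreover have "fib (Suc m) > 0" by (simp add: fib_neq_0_nat)
    ultimately show False using 1 eq m by simp
  qed
  then show "par v < v" "par v \<in> S" by auto
  have c2: "card (S - {v, par v}) = m"
    using m assms(3) fin p by (simp add: card_Diff_subset)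
  have 2: "card (forest_matchings par (S - {v, par v})) \<le> fib (Suc m)"
    using card_forest_matchings_le[of "S - {v, par v}" par] fin c2 by simp
  have "card (forest_matchings par S) = card (forest_matchings par (S - {v})) +
      card (forest_matchings par (S - {v, par v}))"
    using card_forest_matchings_Max[OF fin assms(3,4), of par] p by auto
  with eq m 1 2 have "card (forest_matchings par (S - {v})) = fib (Suc (Suc m))"
    "card (forest_matchings par (S - {v, par v})) = fib (Suc m)" by auto
  then show "extremal par (S - {v})" "extremal par (S - {v, par v})"
    using fin c1 c2 by (auto simp: extremal_def)
qed

text \<open>Deleting the maximum keeps the set extremal, so maxima can be peeled off until
  \<open>j\<close> is the largest element; \<open>i\<close> is still present then and keeps the set
  large enough. Thus only the least element of an extremal set can lack a parent in it.\<close>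

lemma extremal_parent:
  assumes "extremal par S" "i \<in> S" "j \<in> S" "i < j"
  shows "par j < j \<and> par j \<in> S"
  using assms
proof (induction "card S" arbitrary: S rule: less_induct)
  case less
  have fin: "finite S" using less.prems by (simp add: extremal_def)
  define v where "v = Max S"
  have v: "v \<in> S" "\<And>i. i \<in> S \<Longrightarrow> i \<le> v"
    using fin less.prems(2) by (auto simp: v_def intro: Max_in)
  have c: "card S \<ge> 2"
    using card_mono[of S "{i, j}"] fin less.prems by auto
  note step = extremal_Max[OF less.prems(1) c v]
  show ?case
  proof (cases "j = v")
    case True
    then show ?thesis using step by simp
  next
    case False
    have "j \<le> v" using v less.prems by blast
    with False less.prems have "i \<in> S - {v}" "j \<in> S - {v}" by auto
    moreover have "card (S - {v}) < card S" using fin v by (meson card_Diff1_less)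
    ultimately show ?thesis using less.hyps[of "S - {v}"] step less.prems by blast
  qed
qed

lemma extremal_hamiltonian_path:
  assumes "extremal par S" "\<And>i. i \<in> S \<Longrightarrow> par i \<le> i"
  shows "\<exists>xs. distinct xs \<and> set xs = S \<and> successively (\<lambda>i j. par i = j \<or> par j = i) xs"
  using assms
proof (induction "card S" arbitrary: S rule: less_induct)
  case less
  have fin: "finite S" using less.prems(1) by (simp add: extremal_def)
  consider "S = {}" | x where "S = {x}" | "card S \<ge> 2"
    using fin by (metis card_0_eq card_1_singletonE le_SucE less_2_cases_iff linorder_not_less One_nat_def)
  then show ?case
  proof cases
    case 1
    then show ?thesis by (intro exI[of _ "[]"]) auto
  next
    case (2 x)
    then show ?thesis by (intro exI[of _ "[x]"]) auto
  next
    case 3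
    define v where "v = Max S"
    have v: "v \<in> S" "\<And>i. i \<in> S \<Longrightarrow> i \<le> v" using fin 3 by (auto simp: v_def intro: Max_in)
    define p where "p = par v"
    note step = extremal_Max[OF less.prems(1) 3 v, folded p_def]
    have "card (S - {v}) < card S" using fin v by (meson card_Diff1_less)
    then obtain xs where xs: "distinct xs" "set xs = S - {v}"
        "successively (\<lambda>i j. par i = j \<or> par j = i) xs"
      using less.hyps[OF _ step(3)] less.prems(2) by auto
    have "p \<in> set xs" using xs(2) step(1,2) by auto
    then obtain as bs where ab: "xs = as @ p # bs" by (auto dest: split_list)
    have "as = [] \<or> bs = []"
    proof (rule ccontr)
      assume "\<not> ?thesis"
      then obtain as' a b bs' where "as = as' @ [a]" "bs = b # bs'"
        by (metis neq_Nil_conv rev_exhaust)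
      with ab have xs': "xs = as' @ a # p # b # bs'" by simp
      have rel: "par a = p \<or> par p = a" "par p = b \<or> par b = p"
        using xs(3) unfolding xs' by (auto simp: successively_append_iff)
      have ab': "a \<in> S" "b \<in> S" "a \<noteq> v" "b \<noteq> v" "a \<noteq> p" "b \<noteq> p" "a \<noteq> b"
        using xs(1,2) unfolding xs' by auto
      \<comment> \<open>A child of \<open>p\<close> loses its parent in the extremal set \<open>S - {v, p}\<close>, so it is its least element.\<close>
      have child: "c \<le> i" if "par c = p" "c \<in> S" "c \<noteq> v" "c \<noteq> p" "i \<in> S" "i \<noteq> v" "i \<noteq> p" for c i
        using extremal_parent[OF step(4), of i c] that by (auto simp: not_le[symmetric])
      have up: "par c < c" if "par c = p" "c \<in> S" "c \<noteq> p" for c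
        using less.prems(2)[OF that(2)] that by auto
      \<comment> \<open>Since \<open>a\<close> and \<open>b\<close> differ, at most one of them is
        the parent of \<open>p\<close>. If both are children, each is at most the other. If one is
        the parent, it is smaller than \<open>p\<close> and hence than the other, a child of
        \<open>p\<close> that should be least.\<close>
      from rel show False
        using child[of a b] child[of b a] up[of a] up[of b] less.prems(2)[OF step(2)] ab'
        by auto
    qed
    then show ?thesis
    proof
      assume "as = []"
      then have "distinct (v # xs)" "set (v # xs) = S"
        "successively (\<lambda>i j. par i = j \<or> par j = i) (v # xs)"
        using xs v(1) p_def ab by auto
      then show ?thesis by blast
    next
      assume "bs = []"
      then have "distinct (xs @ [v])" "set (xs @ [v]) = S"
        "successively (\<lambda>i j. par i = j \<or> par j = i) (xs @ [v])"
        using xs v(1) p_def ab by (auto simp: successively_append_iff)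
      then show ?thesis by blast
    qed
  qed
qed

text \<open>Truncated subtraction makes 0 its own parent, so \<open>j - 1\<close> describes the path
  rooted at 0. Both deletions in the recursion leave shorter paths, so it holds with equality
  throughout.\<close>

lemma card_forest_matchings_pred:
  "card (forest_matchings (\<lambda>j. j - 1) {..<n}) = fib (n + 1)"
proof (induction n rule: fib.induct)
  case 1
  show ?case by simp
next
  case 2
  have "{..<Suc 0} = {0}" by auto
  then show ?case
    using card_forest_matchings_Max[of "{0}" 0 "\<lambda>j. j - 1"] by simp
next
  case (3 n)
  have "{..<Suc (Suc n)} - {Suc n} = {..<Suc n}" "{..<Suc (Suc n)} - {Suc n, n} = {..<n}" by auto
  then show ?case
    using card_forest_matchings_Max[of "{..<Suc (Suc n)}" "Suc n" "\<lambda>j. j - 1"] 3 by simp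
qed

text \<open>This is where the bound becomes strict for disconnected graphs.\<close>

lemma card_forest_matchings_split:
  assumes "r < n" "\<And>j. r \<le> j \<Longrightarrow> j < n \<Longrightarrow> r \<le> par j"
  shows "card (forest_matchings par {..<n}) + fib r * fib (n - r) \<le> fib (n + 1)"
proof -
  let ?L = "forest_matchings par {..<r}" and ?R = "forest_matchings par {r..<n}"
  let ?f = "\<lambda>X. (X \<inter> {..<r}, X \<inter> {r..<n})"
  have "inj_on ?f (forest_matchings par {..<n})"
  proof (rule inj_onI)
    fix X Y assume X: "X \<in> forest_matchings par {..<n}" and Y: "Y \<in> forest_matchings par {..<n}"
      and e: "?f X = ?f Y"
    have "Z = Z \<inter> {..<r} \<union> Z \<inter> {r..<n}" if "Z \<in> forest_matchings par {..<n}" for Z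
      using that by (auto simp: forest_matchings_def)
    from this[OF X] this[OF Y] e show "X = Y" by simp
  qed
  moreover have "?f ` forest_matchings par {..<n} \<subseteq> ?L \<times> ?R"
  proof
    fix P assume "P \<in> ?f ` forest_matchings par {..<n}"
    then obtain X where X: "X \<in> forest_matchings par {..<n}" "P = ?f X" by blast
    have "par j < r" if "j \<in> X" "j < r" for j
      using X(1) that by (auto simp: forest_matchings_def intro: less_trans)
    moreover have "par j \<ge> r" if "j \<in> X" "j \<ge> r" for j
      using X(1) that assms by (auto simp: forest_matchings_def)
    ultimately show "P \<in> ?L \<times> ?R" using X by (auto simp: forest_matchings_def)
  qed
  ultimately have "card (forest_matchings par {..<n}) \<le> card (?L \<times> ?R)"
    by (intro card_inj_on_le) (auto simp: finite_forest_matchings)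
  also have "\<dots> \<le> fib (r + 1) * fib (n - r + 1)"
    using card_forest_matchings_le[of "{..<r}" par] card_forest_matchings_le[of "{r..<n}" par]
    by (simp add: card_cartesian_product mult_le_mono)
  \<comment> \<open>The addition formula splits \<open>fib (n + 1)\<close> into
    \<open>fib (r + 1) * fib (n - r + 1)\<close> and \<open>fib r * fib (n - r)\<close>. For
    \<open>r > 0\<close> the latter counts the matchings of a path on \<open>n\<close> vertices that
    use the edge behind its first \<open>r\<close> vertices.\<close>
  finally show ?thesis
    using fib_add[of r "n - r"] assms(1) by (cases r) (auto simp: algebra_simps)
qed

section \<open>Search orders\<close>

text \<open>The vertices are placed at positions \<open>0, 1, \<dots>\<close>; the parent of a position is the earlier
  position it was discovered from, and a root is only opened when nothing can be discovered.\<close>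

definition search_order ::
    "'a set \<Rightarrow> 'a set set \<Rightarrow> nat \<Rightarrow> (nat \<Rightarrow> 'a) \<Rightarrow> (nat \<Rightarrow> nat) \<Rightarrow> bool" where
  "search_order V E k ord par \<longleftrightarrow> inj_on ord {..<k} \<and> ord ` {..<k} \<subseteq> V \<and>
     (\<forall>j<k. par j \<le> j \<and> (par j < j \<longrightarrow> {ord (par j), ord j} \<in> E) \<and>
        (par j = j \<longrightarrow> (\<forall>i<j. \<forall>v\<in>V - ord ` {..<j}. {ord i, v} \<notin> E)))"

lemma search_order_cong:
  assumes "\<And>j. j < k \<Longrightarrow> ord j = ord' j" "\<And>j. j < k \<Longrightarrow> par j = par' j"
  shows "search_order V E k ord par \<longleftrightarrow> search_order V E k ord' par'"
proof -
  define P where "P ord par j \<longleftrightarrow> par j \<le> j \<and> (par j < j \<longrightarrow> {ord (par j), ord j} \<in> E) \<and>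
    (par j = j \<longrightarrow> (\<forall>i<j. \<forall>v\<in>V - ord ` {..<j}. {ord i, v} \<notin> E))" for ord par and j :: nat
  have 1: "inj_on ord {..<k} = inj_on ord' {..<k}" by (rule inj_on_cong) (simp add: assms)
  have 2: "ord ` {..<j} = ord' ` {..<j}" if "j \<le> k" for j
    using that assms(1) by (intro image_cong) auto
  have "P ord par j = P ord' par' j" if "j < k" for j
  proof -
    have "par j = par' j" "ord j = ord' j" "ord ` {..<j} = ord' ` {..<j}"
      using that assms 2 by auto
    moreover have "ord i = ord' i" if "i < j" for i using that \<open>j < k\<close> assms by auto
    ultimately show ?thesis by (simp add: P_def)
  qed
  then have "(\<forall>j<k. P ord par j) = (\<forall>j<k. P ord' par' j)" by blast
  then show ?thesis unfolding search_order_def 1 2[OF order_refl] P_def by blast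
qed

lemma search_order_Suc:
  "search_order V E (Suc k) ord par \<longleftrightarrow> search_order V E k ord par \<and> ord k \<in> V - ord ` {..<k} \<and>
    par k \<le> k \<and> (par k < k \<longrightarrow> {ord (par k), ord k} \<in> E) \<and>
    (par k = k \<longrightarrow> (\<forall>i<k. \<forall>v\<in>V - ord ` {..<k}. {ord i, v} \<notin> E))"
proof -
  have "(\<forall>j<Suc k. P j) \<longleftrightarrow> (\<forall>j<k. P j) \<and> P k" for P by (auto simp: less_Suc_eq)
  then show ?thesis
    unfolding search_order_def lessThan_Suc inj_on_insert image_insert insert_subset by auto
qed

lemma search_order_update:
  "search_order V E k (ord(k := v)) (par(k := p)) \<longleftrightarrow> search_order V E k ord par"
  "(ord(k := v)) ` {..<k} = ord ` {..<k}"
  by (rule search_order_cong) auto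

lemma search_order_child:
  assumes "search_order V E k ord par" "v \<in> V - ord ` {..<k}" "p < k" "{ord p, v} \<in> E"
  shows "search_order V E (Suc k) (ord(k := v)) (par(k := p))"
  unfolding search_order_Suc search_order_update using assms by auto

lemma search_order_root:
  assumes "search_order V E k ord par" "v \<in> V - ord ` {..<k}"
    "\<And>i w. i < k \<Longrightarrow> w \<in> V - ord ` {..<k} \<Longrightarrow> {ord i, w} \<notin> E"
  shows "search_order V E (Suc k) (ord(k := v)) (par(k := k))"
  unfolding search_order_Suc search_order_update using assms by auto

lemma search_order_exists:
  assumes "finite V" "k \<le> card V"
  shows "\<exists>ord par. search_order V E k ord par"
  using assms(2)
proof (induction k)
  case 0
  show ?case by (auto simp: search_order_def)
next
  case (Suc k)
  then obtain ord par where so: "search_order V E k ord par" by auto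
  have "card (ord ` {..<k}) \<le> k" using card_image_le[of "{..<k}" ord] by simp
  then have "card (V - ord ` {..<k}) > 0"
    using Suc.prems diff_card_le_card_Diff[of "ord ` {..<k}" V] by simp
  then obtain v where v: "v \<in> V - ord ` {..<k}" by (auto simp: card_gt_0_iff)
  show ?case
  proof (cases "\<exists>i<k. \<exists>w\<in>V - ord ` {..<k}. {ord i, w} \<in> E")
    case True
    then show ?thesis using search_order_child[OF so] by blast
  next
    case False
    then show ?thesis using search_order_root[OF so v] by blast
  qed
qed

section \<open>Cuts and their traces on the search forest\<close>

text \<open>\<open>A\<close> may be empty or all of \<open>V\<close>, so the empty set always
  belongs. This keeps connectivity out of the injection into forest matchings; the empty set is
  dealt with separately afterwards.\<close>

definition all_cuts :: "'a set \<Rightarrow> 'a set set \<Rightarrow> 'a set set set" where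
  "all_cuts V E = {M. matching E M \<and> (\<exists>A\<subseteq>V. M = edges_between E A (V - A))}"

lemma edges_between_iff:
  assumes "simple_graph V E" "A \<subseteq> V" "{a, b} \<in> E"
  shows "{a, b} \<in> edges_between E A (V - A) \<longleftrightarrow> (a \<in> A) \<noteq> (b \<in> A)"
proof -
  have "a \<in> V" "b \<in> V" using assms by (auto simp: simple_graph_def)
  then show ?thesis using assms(3) by (auto simp: edges_between_def doubleton_eq_iff)
qed

lemma edges_between_subset: "edges_between E A B \<subseteq> E"
  by (auto simp: edges_between_def)

lemma simple_graph_edgeE:
  assumes "simple_graph V E" "e \<in> E"
  obtains a b where "e = {a, b}" "a \<noteq> b" "a \<in> V" "b \<in> V"
proof -
  have "card e = 2" "e \<subseteq> V" using assms by (auto simp: simple_graph_def)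
  then show ?thesis using that by (auto simp: card_2_iff)
qed

lemma finite_all_cuts: "simple_graph V E \<Longrightarrow> finite (all_cuts V E)"
proof -
  assume g: "simple_graph V E"
  then have "E \<subseteq> Pow V" "finite V" by (auto simp: simple_graph_def)
  then have "finite E" using finite_subset finite_Pow_iff by blast
  moreover have "all_cuts V E \<subseteq> Pow E" by (auto simp: all_cuts_def matching_def)
  ultimately show ?thesis using finite_subset finite_Pow_iff by blast
qed

lemma matching_cuts_subset: "matching_cuts V E \<subseteq> all_cuts V E"
proof
  fix M assume "M \<in> matching_cuts V E"
  then obtain A B where "matching E M" "A \<inter> B = {}" "A \<union> B = V" "M = edges_between E A B"
    by (auto simp: matching_cuts_def matching_cut_def)
  moreover from this have "B = V - A" by blast
  ultimately show "M \<in> all_cuts V E" by (auto simp: all_cuts_def)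
qed

lemma nonempty_all_cuts:
  assumes "M \<in> all_cuts V E" "M \<noteq> {}"
  shows "M \<in> matching_cuts V E"
proof -
  obtain A where A: "matching E M" "A \<subseteq> V" "M = edges_between E A (V - A)"
    using assms(1) by (auto simp: all_cuts_def)
  obtain e where "e \<in> M" using assms(2) by blast
  then have "A \<noteq> {}" "V - A \<noteq> {}" using A(3) by (auto simp: edges_between_def)
  moreover have "A \<inter> (V - A) = {}" "A \<union> (V - A) = V" using A(2) by auto
  ultimately show ?thesis
    using A(1,3) unfolding matching_cuts_def matching_cut_def mem_Collect_eq by metis
qed

locale search_ordered =
  fixes V :: "'a set" and E n ord par
  assumes simple: "simple_graph V E"
    and card_V: "card V = n"
    and search_order: "search_order V E n ord par"
begin

lemma inj_ord: "i < n \<Longrightarrow> j < n \<Longrightarrow> ord i = ord j \<longleftrightarrow> i = j"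
  using search_order by (auto simp: search_order_def inj_on_def)

lemma finite_V: "finite V" using simple by (simp add: simple_graph_def)

lemma ord_image: "ord ` {..<n} = V"
  using search_order card_V finite_V
  by (intro card_subset_eq) (auto simp: search_order_def card_image)

lemma ord_in: "j < n \<Longrightarrow> ord j \<in> V" using ord_image by auto

lemma ordE: assumes "v \<in> V" obtains j where "j < n" "v = ord j"
  using assms ord_image by auto

lemma par_le: "j < n \<Longrightarrow> par j \<le> j"
  using search_order by (auto simp: search_order_def)

lemma par_edge: "j < n \<Longrightarrow> par j < j \<Longrightarrow> {ord (par j), ord j} \<in> E"
  using search_order by (auto simp: search_order_def)

text \<open>When \<open>r\<close> was opened no placed vertex had an unplaced neighbour. So no edge
  of the whole graph, and not only of the forest, crosses from below \<open>r\<close> to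
  \<open>r\<close> or beyond.\<close>

lemma root:
  assumes "par r = r" "i < r" "r \<le> j" "j < n"
  shows "{ord i, ord j} \<notin> E"
proof -
  have "ord j \<in> V - ord ` {..<r}" using assms ord_in inj_ord by auto
  moreover have "r < n" using assms by simp
  ultimately show ?thesis using search_order assms(1,2) unfolding search_order_def by blast
qed

lemma par_ge_root:
  assumes "par r = r" "r \<le> j" "j < n"
  shows "r \<le> par j"
  using root[of r "par j" j] par_edge[of j] par_le[of j] assms by (cases "par j < r") auto

text \<open>Components are intervals of positions.\<close>

lemma constant_on_edges:
  assumes D: "\<And>j. j < n \<Longrightarrow> D (par j) = D j" and "i < n" "j < n" "{ord i, ord j} \<in> E"
  shows "D i = D j"
  using assms(2-)
proof (induction i j rule: linorder_wlog)
  case (sym i j)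
  then show ?case by (simp add: insert_commute)
next
  case (le i j)
  \<comment> \<open>The last root at or before \<open>i\<close>. A root in the interval from
    \<open>i + 1\<close> to \<open>j\<close> would be crossed by the edge, so no position after
    \<open>r\<close> up to \<open>j\<close> is a root, and following parents from \<open>i\<close>
    and from \<open>j\<close> ends in \<open>r\<close>.\<close>
  define r where "r = Max {r. r \<le> i \<and> par r = r}"
  have 0: "par 0 = 0" using par_le[of 0] le by auto
  have fin: "finite {r. r \<le> i \<and> par r = r}" by simp
  have "{r. r \<le> i \<and> par r = r} \<noteq> {}" using 0 by blast
  from Max_in[OF fin this] have r: "r \<le> i" "par r = r" by (simp_all add: r_def)
  have r_max: "s \<le> r" if "s \<le> i" "par s = s" for s
    using that Max_ge[OF fin] by (auto simp: r_def)
  have no_root: "par s < s" if "r < s" "s \<le> j" for s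
  proof -
    have "par s \<noteq> s"
    proof
      assume s: "par s = s"
      with r_max that(1) have "i < s" by (meson leD leI)
      with root[OF s, of i j] that le show False by auto
    qed
    then show ?thesis using par_le[of s] that le by auto
  qed
  have "D k = D r" if "r \<le> k" "k \<le> j" for k
    using that
  proof (induction k rule: less_induct)
    case (less k)
    show ?case
    proof (cases "k = r")
      case False
      then have "par k < k" using no_root less.prems by auto
      moreover have "r \<le> par k" using par_ge_root[OF r(2)] less.prems le by auto
      moreover have "par k \<le> j" using \<open>par k < k\<close> less.prems(2) by simp
      ultimately have "D (par k) = D r" using less.IH by blast
      then show ?thesis using D[of k] less.prems le by auto
    qed simp
  qed
  from this[of i] this[of j] show ?case using le.hyps r(1) by simp
qed

definition forest_part :: "'a set set \<Rightarrow> nat set" where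
  "forest_part M = {j. j < n \<and> par j < j \<and> {ord (par j), ord j} \<in> M}"

text \<open>The condition \<open>par j < j\<close> disappears because a root is its own parent and
  cannot lie on both sides.\<close>

lemma forest_part_edges_between:
  assumes "A \<subseteq> V"
  shows "forest_part (edges_between E A (V - A)) = {j. j < n \<and> (ord (par j) \<in> A) \<noteq> (ord j \<in> A)}"
proof (intro set_eqI)
  fix j
  let ?M = "edges_between E A (V - A)"
  show "j \<in> forest_part ?M \<longleftrightarrow> j \<in> {j. j < n \<and> (ord (par j) \<in> A) \<noteq> (ord j \<in> A)}"
  proof (cases "j < n \<and> par j < j")
    case True
    then show ?thesis
      using edges_between_iff[OF simple assms par_edge[of j]] by (simp add: forest_part_def)
  next
    case False
    then have "j < n \<Longrightarrow> par j = j" using par_le[of j] by auto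
    with False show ?thesis by (auto simp: forest_part_def)
  qed
qed

text \<open>Equal traces mean that membership in the symmetric difference of \<open>A\<close> and
  \<open>B\<close> is constant along forest edges, hence along all edges by
  \<open>constant_on_edges\<close>. Changing sides on a union of components does not change the
  cut.\<close>

lemma edges_between_eq:
  assumes "A \<subseteq> V" "B \<subseteq> V"
    and f: "forest_part (edges_between E A (V - A)) = forest_part (edges_between E B (V - B))"
  shows "edges_between E A (V - A) = edges_between E B (V - B)"
proof -
  have "((ord (par j) \<in> A) \<noteq> (ord (par j) \<in> B)) = ((ord j \<in> A) \<noteq> (ord j \<in> B))" if "j < n" for j
    using f that unfolding forest_part_edges_between[OF assms(1)]
      forest_part_edges_between[OF assms(2)] by blast
  from constant_on_edges[of "\<lambda>j. (ord j \<in> A) \<noteq> (ord j \<in> B)", OF this]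
  have *: "((u \<in> A) \<noteq> (u \<in> B)) = ((w \<in> A) \<noteq> (w \<in> B))" if "{u, w} \<in> E" "u \<in> V" "w \<in> V" for u w
    using that by (elim ordE) auto
  have "e \<in> edges_between E A (V - A) \<longleftrightarrow> e \<in> edges_between E B (V - B)" if e: "e \<in> E" for e
  proof -
    obtain u w where uw: "e = {u, w}" "u \<in> V" "w \<in> V" using simple_graph_edgeE[OF simple e] .
    show ?thesis
      using *[of u w] uw e edges_between_iff[OF simple assms(1), of u w]
        edges_between_iff[OF simple assms(2), of u w] by auto
  qed
  then show ?thesis using edges_between_subset by blast
qed

lemma inj_forest_part: "inj_on forest_part (all_cuts V E)"
proof (rule inj_onI)
  fix M N assume M: "M \<in> all_cuts V E" and N: "N \<in> all_cuts V E"
    and eq: "forest_part M = forest_part N"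
  obtain A where A: "A \<subseteq> V" "M = edges_between E A (V - A)" using M by (auto simp: all_cuts_def)
  obtain B where B: "B \<subseteq> V" "N = edges_between E B (V - B)" using N by (auto simp: all_cuts_def)
  show "M = N" using edges_between_eq[OF A(1) B(1)] A(2) B(2) eq by simp
qed

lemma forest_part_matching:
  assumes "matching E M"
  shows "forest_part M \<in> forest_matchings par {..<n}"
proof -
  have "par i \<noteq> j \<and> par i \<noteq> par j" if ij: "i \<in> forest_part M" "j \<in> forest_part M" "i \<noteq> j" for i j
  proof -
    have i: "i < n" "par i < i" "{ord (par i), ord i} \<in> M"
      and j: "j < n" "par j < j" "{ord (par j), ord j} \<in> M"
      using ij(1,2) by (auto simp: forest_part_def)
    \<comment> \<open>Different positions name different edges, because otherwise
      \<open>i = par j < j = par i < i\<close>.\<close>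
    have "{ord (par i), ord i} \<noteq> {ord (par j), ord j}"
    proof
      assume "{ord (par i), ord i} = {ord (par j), ord j}"
      then have "ord i = ord j \<or> ord i = ord (par j) \<and> ord j = ord (par i)"
        unfolding doubleton_eq_iff by metis
      then have "i = j \<or> i = par j \<and> j = par i"
        using i(1,2) j(1,2) inj_ord[of i j] inj_ord[of i "par j"] inj_ord[of j "par i"]
        by (meson less_trans)
      then show False using ij(3) i(2) j(2) by (metis less_asym)
    qed
    then have "disjnt {ord (par i), ord i} {ord (par j), ord j}"
      using assms pairwiseD[OF _ i(3) j(3), of disjnt] by (simp add: matching_def)
    then have "ord (par i) \<noteq> ord j" "ord (par i) \<noteq> ord (par j)" by (auto simp: disjnt_def)
    then show ?thesis by metis
  qed
  then show ?thesis by (auto simp: forest_matchings_def forest_part_def)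
qed

lemma forest_part_in: "M \<in> all_cuts V E \<Longrightarrow> forest_part M \<in> forest_matchings par {..<n}"
  using forest_part_matching by (auto simp: all_cuts_def)

lemma card_all_cuts_le: "card (all_cuts V E) \<le> card (forest_matchings par {..<n})"
  by (rule card_inj_on_le[OF inj_forest_part])
    (auto simp: forest_part_in finite_forest_matchings)

text \<open>Disconnectedness, read off the search order: position 0 is always a root, and a later
  one closes off the vertices before it. Without a later root, an empty trace spreads the side of
  \<open>ord 0\<close> to every vertex. In this form the program can test it.\<close>

lemma empty_matching_cut: "{} \<in> matching_cuts V E \<longleftrightarrow> (\<exists>r<n. 0 < r \<and> par r = r)"
proof
  assume "{} \<in> matching_cuts V E"
  then obtain A B where AB: "A \<noteq> {}" "B \<noteq> {}" "A \<inter> B = {}" "A \<union> B = V" "edges_between E A B = {}"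
    by (auto simp: matching_cuts_def matching_cut_def)
  then have B: "B = V - A" and A: "A \<subseteq> V" by auto
  show "\<exists>r<n. 0 < r \<and> par r = r"
  proof (rule ccontr)
    assume no: "\<not> ?thesis"
    have "forest_part (edges_between E A (V - A)) = {}"
      using AB(5) B by (auto simp: forest_part_def)
    then have *: "(ord (par j) \<in> A) = (ord j \<in> A)" if "j < n" for j
      using that unfolding forest_part_edges_between[OF A] by auto
    have "(ord j \<in> A) = (ord 0 \<in> A)" if "j < n" for j
      using that
    proof (induction j rule: less_induct)
      case (less j)
      show ?case
      proof (cases "j = 0")
        case False
        then have "par j < j" using no par_le[of j] less.prems by (auto simp: le_less)
        then show ?thesis
          using less.IH[of "par j"] *[OF less.prems] less.prems by simp
      qed simp
    qed
    then have "V \<subseteq> A \<or> V \<inter> A = {}" using ord_image by auto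
    then show False using AB by auto
  qed
next
  assume "\<exists>r<n. 0 < r \<and> par r = r"
  then obtain r where r: "r < n" "0 < r" "par r = r" by auto
  define A where "A = ord ` {..<r}"
  have "ord 0 \<in> A" using r by (auto simp: A_def)
  moreover have "ord r \<in> V - A" using r ord_in inj_ord by (auto simp: A_def)
  moreover have "edges_between E A (V - A) = {}"
  proof -
    have "{a, b} \<notin> E" if ab: "a \<in> A" "b \<in> V - A" for a b
    proof -
      obtain i where i: "i < r" "a = ord i" using ab(1) unfolding A_def by blast
      obtain j where j: "j < n" "b = ord j" using ab ordE by blast
      moreover have "r \<le> j" using ab j by (auto simp: A_def not_less[symmetric])
      ultimately show ?thesis using root r i by auto
    qed
    then show ?thesis by (auto simp: edges_between_def)
  qed
  moreover have "A \<union> (V - A) = V" using ord_in r by (auto simp: A_def)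
  moreover have "matching E {}" by (simp add: matching_def)
  moreover have "A \<inter> (V - A) = {}" by blast
  ultimately show "{} \<in> matching_cuts V E"
    unfolding matching_cuts_def matching_cut_def mem_Collect_eq by (metis empty_iff)
qed

lemma empty_all_cuts: "{} \<in> all_cuts V E"
  by (auto simp: all_cuts_def matching_def edges_between_def)

lemma matching_cuts_connected:
  assumes "{} \<notin> matching_cuts V E"
  shows "matching_cuts V E = all_cuts V E - {{}}"
  using assms nonempty_all_cuts matching_cuts_subset[of V E] by blast

text \<open>Here all of \<open>all_cuts\<close> may count, the empty set included, so the loss must
  come from splitting the forest at the second root.\<close>

lemma card_matching_cuts_disconnected:
  assumes "{} \<in> matching_cuts V E"
  shows "\<exists>r. 0 < r \<and> r < n \<and> card (matching_cuts V E) + fib r * fib (n - r) \<le> fib (n + 1)"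
proof -
  obtain r where r: "r < n" "0 < r" "par r = r" using assms empty_matching_cut by auto
  have "card (matching_cuts V E) \<le> card (forest_matchings par {..<n})"
    using card_mono[OF finite_all_cuts[OF simple] matching_cuts_subset] card_all_cuts_le
    by linarith
  moreover have "card (forest_matchings par {..<n}) + fib r * fib (n - r) \<le> fib (n + 1)"
    using card_forest_matchings_split[OF r(1)] par_ge_root[OF r(3)] by blast
  ultimately show ?thesis using r by force
qed

lemma card_matching_cuts_connected:
  assumes "{} \<notin> matching_cuts V E"
  shows "card (matching_cuts V E) = card (all_cuts V E) - 1" "card (all_cuts V E) > 0"
  using matching_cuts_connected[OF assms] empty_all_cuts finite_all_cuts[OF simple]
  by (auto simp: card_gt_0_iff)

lemma card_matching_cuts_le: "card (matching_cuts V E) \<le> fib (n + 1) - 1"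
proof (cases "{} \<in> matching_cuts V E")
  case True
  then obtain r where r: "0 < r" "r < n" "card (matching_cuts V E) + fib r * fib (n - r) \<le> fib (n + 1)"
    using card_matching_cuts_disconnected by blast
  have "fib r * fib (n - r) > 0" using r by (simp add: fib_neq_0_nat)
  with r show ?thesis by linarith
next
  case False
  then show ?thesis
    using card_matching_cuts_connected card_all_cuts_le card_forest_matchings_le[of "{..<n}" par]
    by fastforce
qed

end

lemma search_orderedE:
  assumes "simple_graph V E"
  obtains ord par where "search_ordered V E (card V) ord par"
proof -
  have "finite V" using assms by (simp add: simple_graph_def)
  then show ?thesis using search_order_exists[of V "card V" E] assms that
    by (auto simp: search_ordered_def)
qed

text \<open>One of \<open>r\<close> and \<open>n - r\<close> is at least 3. A saving of 1 only
  repeats the general bound, and 2 makes it strict. The constant 5 is sharp: for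
  \<open>n = 4\<close>, \<open>r = 2\<close> the product is 1, and two disjoint edges have 4
  matching cuts, which is \<open>fib 5 - 1\<close>.\<close>

lemma fib_mult_ge_2:
  assumes "0 < r" "r < n" "n \<ge> 5"
  shows "fib r * fib (n - r) \<ge> 2"
proof -
  have two: "fib k \<ge> 2" if "k \<ge> 3" for k
    using fib_mono[OF that] by (simp add: eval_nat_numeral)
  have pos: "fib r \<ge> 1" "fib (n - r) \<ge> 1" using assms by (auto simp: fib_neq_0_nat Suc_le_eq)
  have "r \<ge> 3 \<or> n - r \<ge> 3" using assms by linarith
  then have "fib r \<ge> 2 \<or> fib (n - r) \<ge> 2" using two by blast
  then show ?thesis using pos mult_le_mono[of 2 "fib r" 1 "fib (n - r)"]
    mult_le_mono[of 1 "fib r" 2 "fib (n - r)"] by auto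
qed

section \<open>Paths\<close>

text \<open>\<open>E\<close> may have chords: a Hamiltonian path alone is a search order, since 0 is
  its only root and nothing precedes it. This covers both the path itself and the candidate in the
  equality case.\<close>

lemma search_ordered_path:
  assumes g: "simple_graph V E" and f: "bij_betw f {..<n} V"
    and E: "\<And>i. Suc i < n \<Longrightarrow> {f i, f (Suc i)} \<in> E"
  shows "search_ordered V E n f (\<lambda>j. j - 1)"
proof
  show "card V = n" using bij_betw_same_card[OF f] by simp
  have "{f (j - 1), f j} \<in> E" if "j < n" "j - 1 < j" for j
    using that E[of "j - 1"] by simp
  then show "search_order V E n f (\<lambda>j. j - 1)"
    using f by (auto simp: search_order_def bij_betw_def)
qed (rule g)

text \<open>In a path the forest is the whole graph, so no outside edge can spoil a forest matching
  and the trace map is onto.\<close>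

lemma card_matching_cuts_path:
  assumes g: "simple_graph V E" and f: "bij_betw f {..<n} V" and n: "n \<ge> 1"
    and E: "\<And>i j. i < n \<Longrightarrow> j < n \<Longrightarrow> {f i, f j} \<in> E \<longleftrightarrow> j = Suc i \<or> i = Suc j"
  shows "card (matching_cuts V E) = fib (n + 1) - 1"
proof -
  interpret search_ordered V E n f "\<lambda>j. j - 1"
    using search_ordered_path[OF g f] E by simp
  have "forest_part ` all_cuts V E = forest_matchings (\<lambda>j. j - 1) {..<n}"
  proof
    show "forest_part ` all_cuts V E \<subseteq> forest_matchings (\<lambda>j. j - 1) {..<n}"
      using forest_part_in by blast
    show "forest_matchings (\<lambda>j. j - 1) {..<n} \<subseteq> forest_part ` all_cuts V E"
    proof
      fix X assume X: "X \<in> forest_matchings (\<lambda>j. j - 1) {..<n}"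
      \<comment> \<open>Walk along the path and change sides on entering each position of
        \<open>X\<close>; the parity counts the changes so far.\<close>
      define A where "A = f ` {j. j < n \<and> even (card (X \<inter> {..j}))}"
      let ?M = "edges_between E A (V - A)"
      have A: "A \<subseteq> V" using ord_in by (auto simp: A_def)
      have fA: "f j \<in> A \<longleftrightarrow> even (card (X \<inter> {..j}))" if "j < n" for j
        using that inj_ord by (auto simp: A_def)
      have step: "(f i \<in> A) \<noteq> (f (Suc i) \<in> A) \<longleftrightarrow> Suc i \<in> X" if "Suc i < n" for i
        using fA[of i] fA[of "Suc i"] that by (auto simp: atMost_Suc Int_insert_right)
      have 0: "0 \<notin> X" using X by (auto simp: forest_matchings_def)
      have "forest_part ?M = X"
      proof (intro set_eqI)
        fix j show "j \<in> forest_part ?M \<longleftrightarrow> j \<in> X"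
          unfolding forest_part_edges_between[OF A]
          using step[of "j - 1"] 0 X by (cases j) (auto simp: forest_matchings_def)
      qed
      moreover have "disjnt d e" if de: "d \<in> ?M" "e \<in> ?M" "d \<noteq> e" for d e
      proof -
        have ex: "\<exists>i. Suc i < n \<and> Suc i \<in> X \<and> e = {f i, f (Suc i)}" if e: "e \<in> ?M" for e
        proof -
          have "e \<in> E" using e edges_between_subset by blast
          then obtain u w where uw: "e = {u, w}" "u \<in> V" "w \<in> V"
            using simple_graph_edgeE[OF g] by metis
          obtain i j where ij: "i < n" "u = f i" "j < n" "w = f j" using uw ordE by metis
          have cross: "(f i \<in> A) \<noteq> (f j \<in> A)"
            using edges_between_iff[OF g A, of u w] e \<open>e \<in> E\<close> uw(1) ij by auto
          have "j = Suc i \<or> i = Suc j" using E[of i j] \<open>e \<in> E\<close> uw ij by auto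
          then show ?thesis
            using step[of i] step[of j] cross ij uw by (auto simp: insert_commute)
        qed
        obtain i where i: "Suc i < n" "Suc i \<in> X" "d = {f i, f (Suc i)}" using ex[OF de(1)] by blast
        obtain j where j: "Suc j < n" "Suc j \<in> X" "e = {f j, f (Suc j)}" using ex[OF de(2)] by blast
        have "i \<noteq> j" using de(3) i j by auto
        then have "i \<noteq> Suc j" "j \<noteq> Suc i"
          using X i(2) j(2) by (force simp: forest_matchings_def)+
        then show ?thesis using \<open>i \<noteq> j\<close> i j by (auto simp: disjnt_def inj_ord)
      qed
      then have "?M \<in> all_cuts V E"
        using A edges_between_subset[of E A "V - A"]
        by (auto simp: all_cuts_def matching_def pairwise_def)
      ultimately show "X \<in> forest_part ` all_cuts V E" by blast
    qed
  qed
  then have "card (all_cuts V E) = fib (n + 1)"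
    using card_image[OF inj_forest_part] card_forest_matchings_pred[of n] by simp
  moreover have "{} \<notin> matching_cuts V E" using empty_matching_cut by auto
  ultimately show ?thesis using card_matching_cuts_connected by simp
qed

lemma simple_graph_path_edges: "simple_graph {..<n} (path_edges n)"
  by (auto simp: simple_graph_def path_edges_def)

lemma path_edges_iff: "{i, j} \<in> path_edges n \<longleftrightarrow> (j = Suc i \<and> j < n) \<or> (i = Suc j \<and> i < n)"
  by (auto simp: path_edges_def doubleton_eq_iff)

lemma card_matching_cuts_path_edges:
  "n \<ge> 1 \<Longrightarrow> card (matching_cuts {..<n} (path_edges n)) = fib (n + 1) - 1"
  by (rule card_matching_cuts_path[of _ _ id])
    (auto simp: simple_graph_path_edges path_edges_iff)

text \<open>Equality is used for two search orders. For an arbitrary one it makes the forest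
  extremal and yields a Hamiltonian path; for the order along that path it makes every matching of
  the path the trace of a matching cut.\<close>

lemma is_path_if_card_eq:
  assumes g: "simple_graph V E" and n5: "card V \<ge> 5"
    and eq: "card (matching_cuts V E) = fib (card V + 1) - 1"
  shows "is_path V E"
proof -
  define n where "n = card V"
  obtain ord par where "search_ordered V E n ord par"
    using search_orderedE[OF g] n_def by blast
  then interpret S: search_ordered V E n ord par .
  have conn: "{} \<notin> matching_cuts V E"
  proof
    assume "{} \<in> matching_cuts V E"
    then obtain r where r: "0 < r" "r < n"
      "card (matching_cuts V E) + fib r * fib (n - r) \<le> fib (n + 1)"
      using S.card_matching_cuts_disconnected by blast
    moreover have "fib r * fib (n - r) \<ge> 2" using fib_mult_ge_2 r n5 n_def by blast
    ultimately show False using eq[folded n_def] by linarith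
  qed
  have all: "card (all_cuts V E) = fib (n + 1)"
    using S.card_matching_cuts_connected[OF conn] eq[folded n_def] fib_neq_0_nat[of "n + 1"]
    by linarith
  then have "extremal par {..<n}"
    using S.card_all_cuts_le card_forest_matchings_le[of "{..<n}" par] by (auto simp: extremal_def)
  then obtain xs where xs: "distinct xs" "set xs = {..<n}"
      "successively (\<lambda>i j. par i = j \<or> par j = i) xs"
    using extremal_hamiltonian_path[of par "{..<n}"] S.par_le by auto
  have len: "length xs = n" using distinct_card[OF xs(1)] xs(2) by simp
  define f where "f i = ord (xs ! i)" for i
  have nth: "xs ! i < n" if "i < n" for i using that xs(2) len nth_mem by blast
  have bij: "bij_betw f {..<n} V"
  proof -
    have "bij_betw (\<lambda>i. xs ! i) {..<n} {..<n}" using bij_betw_nth[OF xs(1)] len xs(2) by auto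
    moreover have "bij_betw ord {..<n} V"
      using S.ord_image S.inj_ord by (auto simp: bij_betw_def inj_on_def)
    ultimately show ?thesis using bij_betw_trans unfolding f_def comp_def by blast
  qed
  have edge: "{f i, f (Suc i)} \<in> E" if "Suc i < n" for i
  proof -
    have "par (xs ! i) = xs ! Suc i \<or> par (xs ! Suc i) = xs ! i"
      using xs(3) that len by (auto simp: successively_conv_nth)
    moreover have "xs ! i \<noteq> xs ! Suc i" using xs(1) that len by (simp add: nth_eq_iff_index_eq)
    ultimately show ?thesis
      using S.par_edge[of "xs ! i"] S.par_edge[of "xs ! Suc i"] S.par_le[of "xs ! i"]
        S.par_le[of "xs ! Suc i"] nth[of i] nth[of "Suc i"] that
      by (auto simp: f_def insert_commute le_less)
  qed
  interpret P: search_ordered V E n f "\<lambda>j. j - 1" by (rule search_ordered_path[OF g bij edge])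
  have onto: "P.forest_part ` all_cuts V E = forest_matchings (\<lambda>j. j - 1) {..<n}"
  proof (rule card_subset_eq)
    show "P.forest_part ` all_cuts V E \<subseteq> forest_matchings (\<lambda>j. j - 1) {..<n}"
      using P.forest_part_in by blast
    show "card (P.forest_part ` all_cuts V E) = card (forest_matchings (\<lambda>j. j - 1) {..<n})"
      unfolding card_image[OF P.inj_forest_part] all card_forest_matchings_pred ..
  qed (simp add: finite_forest_matchings)
  have no_chord: "{f i, f j} \<notin> E" if ij: "Suc i < j" "j < n" for i j
  proof
    assume e: "{f i, f j} \<in> E"
    \<comment> \<open>The single path edge between positions \<open>i\<close> and
      \<open>i + 1\<close>. A cut with this trace changes sides only there, so the chord from
      \<open>i\<close> to \<open>j\<close> crosses as well and meets that edge in
      \<open>f i\<close>.\<close>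
    have "{Suc i} \<in> forest_matchings (\<lambda>j. j - 1) {..<n}"
      using ij by (auto simp: forest_matchings_def)
    then obtain M where M: "M \<in> all_cuts V E" "P.forest_part M = {Suc i}"
      using onto by (metis imageE)
    then obtain A where A: "A \<subseteq> V" "M = edges_between E A (V - A)" "matching E M"
      by (auto simp: all_cuts_def)
    have *: "(f (k - 1) \<in> A) \<noteq> (f k \<in> A) \<longleftrightarrow> k = Suc i" if "k < n" for k
      using M(2) that unfolding A(2) P.forest_part_edges_between[OF A(1)] by auto
    have "(f k \<in> A) = (f (Suc i) \<in> A)" if "Suc i \<le> k" "k < n" for k
      using that
    proof (induction k rule: dec_induct)
      case (step k)
      then show ?case using *[of "Suc k"] by auto
    qed simp
    from this[of j] have "(f i \<in> A) \<noteq> (f j \<in> A)" using *[of "Suc i"] ij by simp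
    then have "{f i, f j} \<in> M" using edges_between_iff[OF g A(1) e] A(2) by simp
    moreover have "Suc i \<in> P.forest_part M" using M(2) by simp
    then have "{f i, f (Suc i)} \<in> M" unfolding P.forest_part_def by simp
    moreover have "{f i, f j} \<noteq> {f i, f (Suc i)}"
      using ij P.inj_ord[of j "Suc i"] by (auto simp: doubleton_eq_iff)
    moreover have "pairwise disjnt M" using A(3) by (simp add: matching_def)
    ultimately have "disjnt {f i, f j} {f i, f (Suc i)}" by (meson pairwiseD)
    then show False by simp
  qed
  have "{f i, f j} \<in> E \<longleftrightarrow> j = Suc i \<or> i = Suc j" if ij: "i < n" "j < n" for i j
  proof (cases i j rule: linorder_cases)
    case less
    then show ?thesis using ij no_chord[of i j] edge[of i] by (cases "j = Suc i") auto
  next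
    case equal
    have "{f i} \<notin> E" using g by (auto simp: simple_graph_def)
    then show ?thesis using equal by auto
  next
    case greater
    then show ?thesis using ij no_chord[of j i] edge[of j]
      by (cases "i = Suc j") (auto simp: insert_commute)
  qed
  then have "graph_iso {..<n} (path_edges n) V E"
    unfolding graph_iso_def using bij by (intro exI[of _ f]) (auto simp: path_edges_iff)
  then show ?thesis unfolding is_path_def using n5 n_def by (intro exI[of _ n]) auto
qed

lemma card_eq_if_is_path:
  assumes g: "simple_graph V E" and "is_path V E"
  shows "card (matching_cuts V E) = fib (card V + 1) - 1"
proof -
  obtain n f where n: "n \<ge> 1" and f: "bij_betw f {..<n} V"
      "\<And>u v. u < n \<Longrightarrow> v < n \<Longrightarrow> {u, v} \<in> path_edges n \<longleftrightarrow> {f u, f v} \<in> E"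
    using assms(2) by (auto simp: is_path_def graph_iso_def)
  have "card V = n" using bij_betw_same_card[OF f(1)] by simp
  then show ?thesis
    using card_matching_cuts_path[OF g f(1) n] f(2) by (auto simp: path_edges_iff)
qed

section \<open>Reasoning about programs\<close>

text \<open>A total-correctness triple with a time bound; the existential form is enough because
  \<open>exec\<close> is deterministic.\<close>

definition runs :: "com \<Rightarrow> state \<Rightarrow> nat \<Rightarrow> (state \<Rightarrow> bool) \<Rightarrow> bool" where
  "runs c s t Q \<longleftrightarrow> (\<exists>t' s'. exec c s t' s' \<and> t' \<le> t \<and> Q s')"

lemma runs_mono: "runs c s t Q \<Longrightarrow> t \<le> u \<Longrightarrow> (\<And>s'. Q s' \<Longrightarrow> R s') \<Longrightarrow> runs c s u R"
  unfolding runs_def by (meson le_trans)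

lemma runs_Seq:
  assumes "runs c s t (\<lambda>s'. runs d s' u Q)"
  shows "runs (Seq c d) s (t + u) Q"
proof -
  obtain t' s' where 1: "exec c s t' s'" "t' \<le> t" "runs d s' u Q" using assms by (auto simp: runs_def)
  then obtain u' s'' where 2: "exec d s' u' s''" "u' \<le> u" "Q s''" by (auto simp: runs_def)
  have "exec (Seq c d) s (t' + u') s''" using 1(1) 2(1) by (rule exec.Seq)
  moreover have "t' + u' \<le> t + u" using 1 2 by simp
  ultimately show ?thesis using 2 unfolding runs_def by blast
qed

lemma runs_Cond:
  assumes "holds b s \<Longrightarrow> runs c s t Q" "\<not> holds b s \<Longrightarrow> runs d s t Q"
  shows "runs (Cond b c d) s (1 + t) Q"
proof -
  obtain t' s' where "exec (if holds b s then c else d) s t' s'" "t' \<le> t" "Q s'"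
    using assms unfolding runs_def by (cases "holds b s") auto
  moreover from this have "exec (Cond b c d) s (1 + t') s'"
    using exec.Cond_True[of b s c t' s' d] exec.Cond_False[of b s d t' s' c]
    by (simp split: if_splits)
  ultimately show ?thesis unfolding runs_def by (meson add_le_mono1 nat_add_left_cancel_le)
qed

fun wregs :: "com \<Rightarrow> nat set" where
  "wregs (Const x k) = {x}" | "wregs (Move x y) = {x}" | "wregs (Inc x) = {x}"
| "wregs (Dec x) = {x}" | "wregs (Read x a i) = {x}"
| "wregs (Seq c d) = wregs c \<union> wregs d" | "wregs (Cond b c d) = wregs c \<union> wregs d"
| "wregs (While b c) = wregs c" | "wregs _ = {}"

fun warrs :: "com \<Rightarrow> nat set" where
  "warrs (Write a i x) = {a}"
| "warrs (Seq c d) = warrs c \<union> warrs d" | "warrs (Cond b c d) = warrs c \<union> warrs d"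
| "warrs (While b c) = warrs c" | "warrs _ = {}"

fun silent :: "com \<Rightarrow> bool" where
  "silent (Out x) \<longleftrightarrow> False"
| "silent (Seq c d) \<longleftrightarrow> silent c \<and> silent d" | "silent (Cond b c d) \<longleftrightarrow> silent c \<and> silent d"
| "silent (While b c) \<longleftrightarrow> silent c" | "silent _ \<longleftrightarrow> True"

text \<open>With the syntactic sets \<open>wregs\<close> and \<open>warrs\<close> this gives a frame
  rule, so loop invariants need only mention what the loop changes.\<close>

definition agree :: "nat set \<Rightarrow> nat set \<Rightarrow> bool \<Rightarrow> state \<Rightarrow> state \<Rightarrow> bool" where
  "agree X Y b s s' \<longleftrightarrow> (\<forall>x. x \<notin> X \<longrightarrow> reg s' x = reg s x) \<and> (\<forall>a. a \<notin> Y \<longrightarrow> arr s' a = arr s a) \<and>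
     (b \<longrightarrow> out s' = out s)"

abbreviation frame :: "com \<Rightarrow> state \<Rightarrow> state \<Rightarrow> bool" where
  "frame c \<equiv> agree (wregs c) (warrs c) (silent c)"

lemma agree_trans: "agree X Y b s s' \<Longrightarrow> agree X Y b s' s'' \<Longrightarrow> agree X Y b s s''"
  by (simp add: agree_def)

lemma agree_mono:
  "agree X Y b s s' \<Longrightarrow> X \<subseteq> X' \<Longrightarrow> Y \<subseteq> Y' \<Longrightarrow> (b' \<Longrightarrow> b) \<Longrightarrow> agree X' Y' b' s s'"
  unfolding agree_def by (meson subsetD)

lemma agree_reg: "agree X Y b s s' \<Longrightarrow> x \<notin> X \<Longrightarrow> reg s' x = reg s x"
  and agree_arr: "agree X Y b s s' \<Longrightarrow> a \<notin> Y \<Longrightarrow> arr s' a = arr s a"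
  and agree_out: "agree X Y b s s' \<Longrightarrow> b \<Longrightarrow> out s' = out s"
  by (simp_all add: agree_def)

lemma exec_frame: "exec c s t s' \<Longrightarrow> frame c s s'"
  by (induction rule: exec.induct) (auto simp: agree_def)

lemma runs_frame:
  assumes "runs c s t Q"
  shows "runs c s t (\<lambda>s'. frame c s s' \<and> Q s')"
  using assms exec_frame unfolding runs_def by blast

text \<open>\<open>m\<close> may drop by any amount; its initial bound \<open>K\<close> limits the
  rounds, each costing one test besides the body, with one failing test at the end. Counting loops
  and the main loop, whose \<open>m\<close> counts matchings still to come, share this rule.\<close>

lemma runs_While:
  assumes "I s" "m s \<le> K"
    and step: "\<And>s. I s \<Longrightarrow> holds b s \<Longrightarrow> runs c s t (\<lambda>s'. I s' \<and> m s' < m s)"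
  shows "runs (While b c) s (K * (t + 1) + 1) (\<lambda>s'. I s' \<and> \<not> holds b s')"
  using assms(1,2)
proof (induction K arbitrary: s rule: less_induct)
  case (less K)
  show ?case
  proof (cases "holds b s")
    case False
    then show ?thesis using less.prems exec.While_False[OF False, of c]
      unfolding runs_def by (intro exI[of _ 1] exI[of _ s]) auto
  next
    case True
    obtain t1 s1 where 1: "exec c s t1 s1" "t1 \<le> t" "I s1" "m s1 < m s"
      using step[OF less.prems(1) True] by (auto simp: runs_def)
    then obtain K' where K: "K = Suc K'" using less.prems(2) by (cases K) auto
    have "runs (While b c) s1 (K' * (t + 1) + 1) (\<lambda>s'. I s' \<and> \<not> holds b s')"
      using less.IH[of K' s1] 1 K less.prems by auto
    then obtain t2 s2 where 2: "exec (While b c) s1 t2 s2" "t2 \<le> K' * (t + 1) + 1" "I s2" "\<not> holds b s2"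
      by (auto simp: runs_def)
    have "exec (While b c) s (1 + t1 + t2) s2" by (rule exec.While_True[OF True 1(1) 2(1)])
    moreover have "1 + t1 + t2 \<le> K * (t + 1) + 1" using 1(2) 2(2) K by simp
    ultimately show ?thesis using 2 unfolding runs_def by blast
  qed
qed

fun loop_free :: "com \<Rightarrow> bool" where
  "loop_free (Seq c d) \<longleftrightarrow> loop_free c \<and> loop_free d"
| "loop_free (Cond b c d) \<longleftrightarrow> loop_free c \<and> loop_free d"
| "loop_free (While b c) \<longleftrightarrow> False"
| "loop_free _ \<longleftrightarrow> True"

fun cost :: "com \<Rightarrow> nat" where
  "cost (Seq c d) = cost c + cost d"
| "cost (Cond b c d) = 1 + max (cost c) (cost d)"
| "cost _ = 1"

text \<open>Symbolic execution: a loop-free program becomes a term that the simplifier evaluates,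
  with \<open>cost\<close> charging the dearer branch. \<open>While\<close> falls under the default
  equation, against which \<open>loop_free\<close> guards.\<close>

fun result :: "com \<Rightarrow> state \<Rightarrow> state" where
  "result (Const x k) s = set_reg x k s"
| "result (Move x y) s = set_reg x (reg s y) s"
| "result (Inc x) s = set_reg x (reg s x + 1) s"
| "result (Dec x) s = set_reg x (reg s x - 1) s"
| "result (Read x a i) s = set_reg x (arr s a (reg s i)) s"
| "result (Write a i x) s = set_arr a (reg s i) (reg s x) s"
| "result (Out x) s = s\<lparr>out := out s @ [reg s x]\<rparr>"
| "result (Seq c d) s = result d (result c s)"
| "result (Cond b c d) s = (if holds b s then result c s else result d s)"
| "result _ s = s"

lemma runs_loop_free:
  assumes "loop_free c" "Q (result c s)" "cost c \<le> t"
  shows "runs c s t Q"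
proof -
  have "\<exists>u\<le>cost c. exec c s u (result c s)" using assms(1)
  proof (induction c arbitrary: s)
    case (Seq c d)
    then obtain u where u: "u \<le> cost c" "exec c s u (result c s)" by auto
    from Seq obtain v where v: "v \<le> cost d" "exec d (result c s) v (result d (result c s))" by auto
    show ?case using exec.Seq[OF u(2) v(2)] u v by (auto intro!: exI[of _ "u + v"])
  next
    case (Cond b c d)
    show ?case
    proof (cases "holds b s")
      case True
      from Cond obtain u where u: "u \<le> cost c" "exec c s u (result c s)" by auto
      show ?thesis using exec.Cond_True[OF True u(2), of d] u True by (auto intro!: exI[of _ "Suc u"])
    next
      case False
      from Cond obtain u where u: "u \<le> cost d" "exec d s u (result d s)" by auto
      show ?thesis using exec.Cond_False[OF False u(2), of c] u False by (auto intro!: exI[of _ "Suc u"])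
    qed
  qed (use exec.intros in auto)
  then show ?thesis using assms(2,3) le_trans unfolding runs_def by blast
qed

lemma runs_Seq_loop_free:
  assumes "loop_free c" "runs d (result c s) u Q" "cost c + u \<le> t"
  shows "runs (Seq c d) s t Q"
proof -
  have "runs c s (cost c) (\<lambda>s'. runs d s' u Q)" using assms(1,2) by (rule runs_loop_free) simp
  then show ?thesis using assms(3) by (intro runs_mono[OF runs_Seq]) auto
qed

text \<open>Register 0 holds the number \<open>n\<close> of vertices throughout; all bounded loops run up to it.\<close>

definition For :: "nat \<Rightarrow> com \<Rightarrow> com" where
  "For i c = Seq (Const i 0) (While (Less i 0) (Seq c (Inc i)))"

lemma wregs_For [simp]: "wregs (For i c) = insert i (wregs c)"
  and warrs_For [simp]: "warrs (For i c) = warrs c"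
  and silent_For [simp]: "silent (For i c) = silent c"
  by (auto simp: For_def)

text \<open>The increment follows the body, so the body must establish the invariant for the state
  in which \<open>i\<close> is already \<open>Suc k\<close>. Each round adds an increment and a test
  to \<open>t\<close>; the final 2 are the initialisation and the failing test.\<close>

lemma runs_For:
  assumes i: "i \<noteq> 0" "i \<notin> wregs c" "0 \<notin> wregs c"
    and init: "I 0 (set_reg i 0 s)"
    and step: "\<And>k s'. k < reg s 0 \<Longrightarrow> agree (insert i (wregs c)) (warrs c) (silent c) s s' \<Longrightarrow>
      reg s' i = k \<Longrightarrow> I k s' \<Longrightarrow> runs c s' t (\<lambda>s''. I (Suc k) (set_reg i (Suc k) s''))"
  shows "runs (For i c) s (reg s 0 * (t + 2) + 2) (\<lambda>s'. I (reg s 0) s')"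
proof -
  let ?n = "reg s 0"
  define J where "J s' \<longleftrightarrow> agree (insert i (wregs c)) (warrs c) (silent c) s s' \<and>
    reg s' i \<le> ?n \<and> I (reg s' i) s'" for s'
  have J0: "J (set_reg i 0 s)" using init by (auto simp: J_def agree_def)
  have n: "reg s' 0 = ?n" if "J s'" for s'
    using that agree_reg[of _ _ _ s s' 0] i by (auto simp: J_def)
  have "runs (While (Less i 0) (Seq c (Inc i))) (set_reg i 0 s) (?n * (t + 1 + 1) + 1)
    (\<lambda>s'. J s' \<and> \<not> holds (Less i 0) s')"
  proof (rule runs_While[where m = "\<lambda>s'. ?n - reg s' i"])
    fix s' assume J: "J s'" and "holds (Less i 0) s'"
    then have lt: "reg s' i < ?n" using n[OF J] by simp
    have "runs c s' t (\<lambda>s''. I (Suc (reg s' i)) (set_reg i (Suc (reg s' i)) s''))"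
      using step[of "reg s' i" s'] J lt by (auto simp: J_def)
    from runs_frame[OF this]
    have "runs c s' t (\<lambda>s''. runs (Inc i) s'' 1 (\<lambda>s''. J s'' \<and> ?n - reg s'' i < ?n - reg s' i))"
    proof (rule runs_mono)
      fix s'' assume a: "frame c s' s'' \<and> I (Suc (reg s' i)) (set_reg i (Suc (reg s' i)) s'')"
      then have r: "reg s'' i = reg s' i" using agree_reg i(2) by blast
      have "agree (insert i (wregs c)) (warrs c) (silent c) s' s''"
        using a by (auto intro: agree_mono)
      then have "agree (insert i (wregs c)) (warrs c) (silent c) s s''"
        using J agree_trans unfolding J_def by blast
      then have "agree (insert i (wregs c)) (warrs c) (silent c) s (set_reg i (Suc (reg s' i)) s'')"
        by (auto simp: agree_def)
      then show "runs (Inc i) s'' 1 (\<lambda>s''. J s'' \<and> ?n - reg s'' i < ?n - reg s' i)"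
        using a lt r by (intro runs_loop_free) (auto simp: J_def)
    qed simp
    then show "runs (Seq c (Inc i)) s' (t + 1) (\<lambda>s''. J s'' \<and> ?n - reg s'' i < ?n - reg s' i)"
      by (rule runs_Seq)
  qed (use J0 in auto)
  then have "runs (While (Less i 0) (Seq c (Inc i))) (set_reg i 0 s) (?n * (t + 2) + 1) (\<lambda>s'. I ?n s')"
  proof (rule runs_mono)
    fix s' assume a: "J s' \<and> \<not> holds (Less i 0) s'"
    then have "reg s' i = ?n" using n[of s'] by (auto simp: J_def)
    then show "I ?n s'" using a by (auto simp: J_def)
  qed simp
  then show ?thesis unfolding For_def
    by - (rule runs_Seq_loop_free[where u = "?n * (t + 2) + 1"]; simp)
qed

text \<open>As there is no multiplication, the adjacency matrix can only be accessed by running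
  through it: registers 1 and 2 hold the row and the column, register 3 the index
  and register 4 the entry.\<close>

definition Scan :: "com \<Rightarrow> com" where
  "Scan c = Seq (Const 3 0) (For 1 (For 2 (Seq (Read 4 0 3) (Seq c (Inc 3)))))"

text \<open>Per entry a read, two increments and a test besides the body; per row the set-up and
  failing test of the inner loop and the increment and test of the outer one; 3 for the two
  remaining initialisations and the last test.\<close>

definition scan_time :: "nat \<Rightarrow> nat \<Rightarrow> nat" where
  "scan_time n t = n * (n * (t + 4) + 4) + 3"

lemma wregs_Scan [simp]: "wregs (Scan c) = {1, 2, 3, 4} \<union> wregs c"
  and warrs_Scan [simp]: "warrs (Scan c) = warrs c"
  and silent_Scan [simp]: "silent (Scan c) = silent c"
  by (auto simp: Scan_def)

text \<open>Indexing the invariant by the set \<open>D\<close> of visited pairs hides the traversal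
  order. The premise \<open>(u, w) \<notin> D\<close> is what lets a body count or write every entry
  exactly once.\<close>

lemma runs_Scan:
  assumes c: "wregs c \<inter> {0, 1, 2, 3, 4} = {}" "0 \<notin> warrs c"
    and inv: "\<And>D s' x v. x \<in> {1, 2, 3, 4} \<Longrightarrow> I D (set_reg x v s') = I D s'"
    and init: "I {} s"
    and step: "\<And>D s' u w. u < reg s 0 \<Longrightarrow> w < reg s 0 \<Longrightarrow> (u, w) \<notin> D \<Longrightarrow> D \<subseteq> {..<reg s 0} \<times> {..<reg s 0} \<Longrightarrow>
      agree ({1, 2, 3, 4} \<union> wregs c) (warrs c) (silent c) s s' \<Longrightarrow>
      reg s' 1 = u \<Longrightarrow> reg s' 2 = w \<Longrightarrow> reg s' 4 = arr s 0 (u * reg s 0 + w) \<Longrightarrow>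
      I D s' \<Longrightarrow> runs c s' t (I (insert (u, w) D))"
  shows "runs (Scan c) s (scan_time (reg s 0) t) (I ({..<reg s 0} \<times> {..<reg s 0}))"
proof -
  define n where "n = reg s 0"
  let ?W = "{1, 2, 3, 4} \<union> wregs c"
  let ?b = "Seq (Read 4 0 3) (Seq c (Inc 3))"
  define In where "In u w s' \<longleftrightarrow> reg s' 3 = u * n + w \<and> I ({..<u} \<times> {..<n} \<union> {u} \<times> {..<w}) s'" for u w s'
  define Ou where "Ou u s' \<longleftrightarrow> reg s' 3 = u * n \<and> I ({..<u} \<times> {..<n}) s'" for u s'
  have inv32: "I D (s'\<lparr>reg := (reg s')(3 := x, 2 := y)\<rparr>) = I D s'" for D s' x y
    using inv[of 2 D "set_reg 3 x s'" y] inv[of 3 D s' x] by simp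
  have inner: "runs ?b s' (t + 2) (\<lambda>s''. In u (Suc w) (set_reg 2 (Suc w) s''))"
    if u: "u < n" and w: "w < n" and a: "agree ?W (warrs c) (silent c) s s'"
      and r: "reg s' 1 = u" "reg s' 2 = w" and I: "In u w s'" for u w s'
  proof -
    let ?s = "set_reg 4 (arr s' 0 (reg s' 3)) s'"
    let ?D = "{..<u} \<times> {..<n} \<union> {u} \<times> {..<w}"
    have "runs c ?s t (I (insert (u, w) ?D))"
    proof (rule step)
      show "agree ?W (warrs c) (silent c) s ?s" using a by (auto simp: agree_def)
      show "reg ?s 4 = arr s 0 (u * reg s 0 + w)"
        using I agree_arr[OF a c(2)] by (simp add: In_def n_def)
      show "I ?D ?s" using I inv by (simp add: In_def)
    qed (use u w r in \<open>auto simp: n_def\<close>)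
    from runs_frame[OF this]
    have "runs c ?s t (\<lambda>s''. runs (Inc 3) s'' 1 (\<lambda>s''. In u (Suc w) (set_reg 2 (Suc w) s'')))"
    proof (rule runs_mono)
      fix s'' assume f: "frame c ?s s'' \<and> I (insert (u, w) ?D) s''"
      then have "reg s'' 3 = u * n + w"
        using agree_reg[of _ _ _ ?s s'' 3] c I by (auto simp: In_def)
      moreover have "insert (u, w) ?D = {..<u} \<times> {..<n} \<union> {u} \<times> {..<Suc w}" by auto
      ultimately show "runs (Inc 3) s'' 1 (\<lambda>s''. In u (Suc w) (set_reg 2 (Suc w) s''))"
        using f by (intro runs_loop_free) (simp_all add: In_def inv32)
    qed simp
    from runs_Seq[OF this]
    have "runs (Seq c (Inc 3)) ?s (t + 1) (\<lambda>s''. In u (Suc w) (set_reg 2 (Suc w) s''))" .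
    then show ?thesis by - (rule runs_Seq_loop_free[where u = "t + 1"]; simp)
  qed
  have outer: "runs (For 2 ?b) s' (n * (t + 2 + 2) + 2) (\<lambda>s''. Ou (Suc u) (set_reg 1 (Suc u) s''))"
    if u: "u < n" and a: "agree ?W (warrs c) (silent c) s s'" and r: "reg s' 1 = u" and O: "Ou u s'" for u s'
  proof -
    have n': "reg s' 0 = n" using agree_reg[OF a, of 0] c n_def by auto
    have "runs (For 2 ?b) s' (reg s' 0 * (t + 2 + 2) + 2) (\<lambda>s''. In u (reg s' 0) s'')"
    proof (rule runs_For)
      show "In u 0 (set_reg 2 0 s')" using O inv by (simp add: In_def Ou_def)
      fix w s'' assume w: "w < reg s' 0" "reg s'' 2 = w" "In u w s''"
        and ag: "agree (insert 2 (wregs ?b)) (warrs ?b) (silent ?b) s' s''"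
      have "agree ?W (warrs c) (silent c) s' s''" using ag by (rule agree_mono) auto
      then have "agree ?W (warrs c) (silent c) s s''" using agree_trans a by blast
      moreover have "reg s'' 1 = u" using agree_reg[OF ag, of 1] r c by auto
      ultimately show "runs ?b s'' (t + 2) (\<lambda>s''. In u (Suc w) (set_reg 2 (Suc w) s''))"
        using inner w u n' by auto
    qed (use c in auto)
    then show ?thesis
    proof (rule runs_mono)
      fix s'' assume "In u (reg s' 0) s''"
      moreover have "{..<u} \<times> {..<n} \<union> {u} \<times> {..<n} = {..<Suc u} \<times> {..<n}" by auto
      ultimately show "Ou (Suc u) (set_reg 1 (Suc u) s'')" using n' inv by (simp add: In_def Ou_def)
    qed (simp add: n')
  qed
  have "runs (For 1 (For 2 ?b)) (set_reg 3 0 s) (reg (set_reg 3 0 s) 0 * (n * (t + 2 + 2) + 2 + 2) + 2)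
    (\<lambda>s'. Ou (reg (set_reg 3 0 s) 0) s')"
  proof (rule runs_For)
    show "Ou 0 (set_reg 1 0 (set_reg 3 0 s))"
      using init inv[of 1 "{}" "set_reg 3 0 s" 0] inv[of 3 "{}" s 0] by (simp add: Ou_def)
    fix u s' assume u: "u < reg (set_reg 3 0 s) 0" "reg s' 1 = u" "Ou u s'"
      and ag: "agree (insert 1 (wregs (For 2 ?b))) (warrs (For 2 ?b)) (silent (For 2 ?b)) (set_reg 3 0 s) s'"
    have "agree ?W (warrs c) (silent c) (set_reg 3 0 s) s'" using ag by (rule agree_mono) auto
    then have "agree ?W (warrs c) (silent c) s s'" by (auto simp: agree_def)
    then show "runs (For 2 ?b) s' (n * (t + 2 + 2) + 2) (\<lambda>s''. Ou (Suc u) (set_reg 1 (Suc u) s''))"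
      using outer u by (auto simp: n_def)
  qed (use c in auto)
  then have "runs (For 1 (For 2 ?b)) (set_reg 3 0 s) (n * (n * (t + 4) + 4) + 2) (I ({..<n} \<times> {..<n}))"
    by (rule runs_mono) (simp_all add: Ou_def n_def algebra_simps)
  then show ?thesis
    unfolding Scan_def scan_time_def n_def[symmetric]
    by - (rule runs_Seq_loop_free[where u = "n * (n * (t + 4) + 4) + 2"]; simp)
qed

section \<open>Lexicographic enumeration of forest matchings\<close>

text \<open>The lexicographic order of characteristic sequences, with position 0 most significant
  and absence before presence.\<close>

definition lex_less :: "nat set \<Rightarrow> nat set \<Rightarrow> bool" where
  "lex_less X Y \<longleftrightarrow> (\<exists>d\<in>Y. d \<notin> X \<and> X \<inter> {..<d} = Y \<inter> {..<d})"

lemma lex_less_irrefl: "\<not> lex_less X X"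
  by (auto simp: lex_less_def)

lemma lex_less_trans:
  assumes "lex_less X Y" "lex_less Y Z"
  shows "lex_less X Z"
proof -
  obtain d where d: "d \<in> Y" "d \<notin> X" "\<And>i. i < d \<Longrightarrow> i \<in> X \<longleftrightarrow> i \<in> Y"
    using assms(1) unfolding lex_less_def by blast
  obtain e where e: "e \<in> Z" "e \<notin> Y" "\<And>i. i < e \<Longrightarrow> i \<in> Y \<longleftrightarrow> i \<in> Z"
    using assms(2) unfolding lex_less_def by blast
  have "min d e \<in> Z \<and> min d e \<notin> X"
    using d e by (cases d e rule: linorder_cases) (auto simp: min_def)
  moreover have "X \<inter> {..<min d e} = Z \<inter> {..<min d e}" using d(3) e(3) by auto
  ultimately show ?thesis unfolding lex_less_def by blast
qed

lemma lex_less_total: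
  assumes "X \<noteq> Y"
  shows "lex_less X Y \<or> lex_less Y X"
proof -
  define d where "d = (LEAST d. (d \<in> X) \<noteq> (d \<in> Y))"
  have "\<exists>d. (d \<in> X) \<noteq> (d \<in> Y)" using assms by blast
  then have "(d \<in> X) \<noteq> (d \<in> Y)" unfolding d_def by (rule LeastI_ex)
  moreover have "X \<inter> {..<d} = Y \<inter> {..<d}" unfolding d_def by (auto dest: not_less_Least)
  ultimately show ?thesis unfolding lex_less_def by blast
qed

text \<open>\<open>addable par X i\<close>: the prefix of \<open>X\<close> below \<open>i\<close> can be continued with \<open>i\<close> instead of
  without it.\<close>

definition addable :: "(nat \<Rightarrow> nat) \<Rightarrow> nat set \<Rightarrow> nat \<Rightarrow> bool" where
  "addable par X i \<longleftrightarrow> i \<notin> X \<and> par i < i \<and> (\<forall>j\<in>X. j < i \<longrightarrow> par i \<noteq> j \<and> par i \<noteq> par j)"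

text \<open>Everything after \<open>i\<close> is dropped, and an element \<open>j < i\<close> cannot
  have \<open>i\<close> as parent, so the only conflicts left are those that \<open>addable\<close>
  excludes.\<close>

lemma addable_in_forest_matchings:
  assumes "X \<in> forest_matchings par {..<n}" "addable par X i" "i < n"
  shows "insert i (X \<inter> {..<i}) \<in> forest_matchings par {..<n}"
proof -
  have *: "par j < j" "par j < n" "j < n" if "j \<in> X" for j
    using assms(1) that by (auto simp: forest_matchings_def)
  have "par j \<noteq> i" "par i \<noteq> j" "par i \<noteq> par j" "par j \<noteq> par i" if "j \<in> X" "j < i" for j
    using *[OF that(1)] that assms(2) unfolding addable_def by force+
  moreover have "par i < i" "par i < n" using assms(2,3) by (auto simp: addable_def)
  ultimately show ?thesis
    using assms(1,3) unfolding forest_matchings_def by auto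
qed

lemma lex_less_addable: "addable par X i \<Longrightarrow> lex_less X (insert i (X \<inter> {..<i}))"
  unfolding lex_less_def addable_def by (intro bexI[of _ i]) auto

text \<open>At the first difference \<open>Z\<close> contains \<open>d\<close> and agrees with
  \<open>X\<close> below it, so the absence of conflicts in \<open>Z\<close> makes \<open>d\<close>
  addable to \<open>X\<close>.\<close>

lemma lex_less_first_difference:
  assumes "Z \<in> forest_matchings par {..<n}" "lex_less X Z"
  obtains d where "d < n" "d \<in> Z" "addable par X d" "X \<inter> {..<d} = Z \<inter> {..<d}"
proof -
  obtain d where d: "d \<in> Z" "d \<notin> X" "X \<inter> {..<d} = Z \<inter> {..<d}"
    using assms(2) by (auto simp: lex_less_def)
  have "j \<in> Z" if "j \<in> X" "j < d" for j using d(3) that by blast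
  then have "addable par X d" "d < n"
    using assms(1) d(1,2) unfolding addable_def forest_matchings_def by force+
  with d that show ?thesis by blast
qed

text \<open>Adding at the last addable position \<open>i\<close> gives the immediate successor of
  \<open>X\<close>. A matching \<open>Z\<close> above \<open>X\<close> first differs from it at an
  addable \<open>d \<le> i\<close>. If \<open>d < i\<close>, then \<open>Z\<close> is also above the
  new set, which agrees with \<open>X\<close> there; if \<open>d = i\<close>, then \<open>Z\<close>
  contains the new set.\<close>

lemma lex_less_addable_iff:
  assumes "X \<in> forest_matchings par {..<n}" "addable par X i"
    and last: "\<And>j. i < j \<Longrightarrow> j < n \<Longrightarrow> \<not> addable par X j"
    and Z: "Z \<in> forest_matchings par {..<n}"
  shows "lex_less Z (insert i (X \<inter> {..<i})) \<longleftrightarrow> lex_less Z X \<or> Z = X"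
    (is "lex_less Z ?Y \<longleftrightarrow> _")
proof
  assume "lex_less Z X \<or> Z = X"
  then show "lex_less Z ?Y" using lex_less_trans lex_less_addable[OF assms(2)] by blast
next
  assume *: "lex_less Z ?Y"
  show "lex_less Z X \<or> Z = X"
  proof (rule ccontr)
    assume "\<not> ?thesis"
    then have "lex_less X Z" using lex_less_total by blast
    then obtain d where d: "d < n" "d \<in> Z" "addable par X d" "X \<inter> {..<d} = Z \<inter> {..<d}"
      using lex_less_first_difference[OF Z] by blast
    have "d \<le> i" using last[of d] d by (meson not_le)
    have eq: "e \<in> X \<longleftrightarrow> e \<in> Z" if "e < d" for e using d(4) that by blast
    show False
    proof (cases "d = i")
      case False
      then have "d < i" using \<open>d \<le> i\<close> by simp
      then have "d \<notin> ?Y" "?Y \<inter> {..<d} = Z \<inter> {..<d}" using d(3,4) by (auto simp: addable_def)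
      then have "lex_less ?Y Z" using d(2) unfolding lex_less_def by blast
      from lex_less_trans[OF this *] show False using lex_less_irrefl by blast
    next
      case True
      obtain e where e: "e \<in> ?Y" "e \<notin> Z" using * unfolding lex_less_def by blast
      then show False using eq[of e] d(2) True by blast
    qed
  qed
qed

lemma lex_less_last:
  assumes "\<And>j. j < n \<Longrightarrow> \<not> addable par X j" "Z \<in> forest_matchings par {..<n}"
  shows "lex_less Z X \<or> Z = X"
  using assms(1) lex_less_first_difference[OF assms(2), of X] lex_less_total[of X Z] by metis

section \<open>Testing a colouring\<close>

text \<open>Unlike in \<open>inj_forest_part\<close>, the cut given by \<open>A\<close> need not be
  a matching. So when the cut rebuilt from \<open>X\<close> is rejected, no matching cut with trace
  \<open>X\<close> is missed.\<close>

lemma (in search_ordered) forest_part_eq_imp_eq: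
  assumes "M \<in> all_cuts V E" "A \<subseteq> V" "forest_part M = forest_part (edges_between E A (V - A))"
  shows "M = edges_between E A (V - A)"
proof -
  obtain B where "B \<subseteq> V" "M = edges_between E B (V - B)"
    using assms(1) by (auto simp: all_cuts_def)
  then show ?thesis using edges_between_eq[of B A] assms(2,3) by simp
qed

lemma matching_iff_degree:
  assumes "simple_graph V E" "C \<subseteq> E"
  shows "matching E C \<longleftrightarrow> (\<forall>u w w'. {u, w} \<in> C \<longrightarrow> {u, w'} \<in> C \<longrightarrow> w = w')"
proof
  assume C: "matching E C"
  show "\<forall>u w w'. {u, w} \<in> C \<longrightarrow> {u, w'} \<in> C \<longrightarrow> w = w'"
  proof (intro allI impI)
    fix u w w' assume uw: "{u, w} \<in> C" "{u, w'} \<in> C"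
    have "{u, w} = {u, w'}"
    proof (rule ccontr)
      assume "{u, w} \<noteq> {u, w'}"
      with C uw have "disjnt {u, w} {u, w'}" unfolding matching_def by (meson pairwiseD)
      then show False by simp
    qed
    then show "w = w'" by (auto simp: doubleton_eq_iff)
  qed
next
  assume *: "\<forall>u w w'. {u, w} \<in> C \<longrightarrow> {u, w'} \<in> C \<longrightarrow> w = w'"
  have "disjnt d e" if de: "d \<in> C" "e \<in> C" "d \<noteq> e" for d e
  proof (rule ccontr)
    assume "\<not> disjnt d e"
    then obtain u where u: "u \<in> d" "u \<in> e" by (auto simp: disjnt_def)
    have "\<exists>w. x = {u, w}" if "x \<in> C" "u \<in> x" for x
      using simple_graph_edgeE[OF assms(1), of x] that assms(2)
      by (metis doubleton_eq_iff insertE singletonD subsetD)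
    then obtain w w' where "d = {u, w}" "e = {u, w'}" using u de by meson
    then show False using * de by blast
  qed
  then show "matching E C" using assms(2) by (simp add: matching_def pairwise_def)
qed

text \<open>The matrix shows every edge twice; the increasing orientation selects one pair per
  edge.\<close>

definition oriented_edges :: "nat set set \<Rightarrow> (nat \<times> nat) set" where
  "oriented_edges C = {(u, w). u < w \<and> {u, w} \<in> C}"

lemma inj_on_oriented_edges: "inj_on (\<lambda>(u, w). {u, w}) (oriented_edges C)"
  by (auto simp: inj_on_def oriented_edges_def doubleton_eq_iff)

lemma image_oriented_edges:
  assumes "simple_graph V E" "C \<subseteq> E"
  shows "(\<lambda>(u, w). {u, w}) ` oriented_edges C = C"
proof
  show "C \<subseteq> (\<lambda>(u, w). {u, w}) ` oriented_edges C"
  proof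
    fix e assume e: "e \<in> C"
    then obtain a b where ab: "e = {a, b}" "a \<noteq> b"
      using simple_graph_edgeE[OF assms(1), of e] assms(2) by (metis subsetD)
    have "e = {min a b, max a b}" "min a b < max a b" using ab by (auto simp: min_def max_def)
    then show "e \<in> (\<lambda>(u, w). {u, w}) ` oriented_edges C"
      using e by (intro image_eqI[of _ _ "(min a b, max a b)"]) (auto simp: oriented_edges_def)
  qed
qed (auto simp: oriented_edges_def)

lemma lists_exactly_Nil: "lists_exactly [] {}"
  unfolding lists_exactly_def by (intro exI[of _ "[]"]) simp

lemma lists_exactly_append:
  assumes "lists_exactly ws \<M>" "distinct es" "set es = oriented_edges C" "C \<notin> \<M>"
    "simple_graph V E" "C \<subseteq> E"
  shows "lists_exactly (ws @ edge_code es) (insert C \<M>)"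
proof -
  obtain ess where ess: "ws = concat (map edge_code ess)"
      "\<forall>es\<in>set ess. distinct (map (\<lambda>(u, v). {u, v}) es)"
      "distinct (map edge_set ess)" "set (map edge_set ess) = \<M>"
    using assms(1) unfolding lists_exactly_def by blast
  have 1: "edge_set es = C"
    unfolding edge_set_def assms(3) by (rule image_oriented_edges[OF assms(5,6)])
  have 2: "distinct (map (\<lambda>(u, v). {u, v}) es)"
    using assms(2,3) inj_on_oriented_edges by (simp add: distinct_map)
  show ?thesis unfolding lists_exactly_def
    by (intro exI[of _ "ess @ [es]"]) (use ess 1 2 assms(4) in auto)
qed

section \<open>The enumeration program\<close>

text \<open>
  Registers: 0 the number \<open>n\<close>; 1--4 used by \<open>Scan\<close>; 5, 6, 19 scratch; 7 and 8 the constants 1 and 0;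
  9, 10, 11 the vertex discovered next, its parent (itself for a root), and whether it has a
  parent; 12 the position; 13 whether there is a second root; 14 whether the enumeration is
  finished; 15 whether the current cut must be rejected; 16 its size; 17, 18 whether there is
  an addable position, and the last one.
  Arrays: 0 adjacency; 1 discovered vertices; 2 the search order; 3 the parent of the vertex at
  a position; 4 colours; 5, 6 the vertices met by the current cut and by the current forest
  matching; 7 the current forest matching.
\<close>

definition discover_root :: com where
  "discover_root = Cond (Equal 11 7) Skip (Seq (Move 9 1) (Move 10 1))"

definition discover :: com where
  "discover = Seq (Read 5 1 1) (Seq (Read 6 1 2)
     (Cond (Equal 5 7) Skip
       (Cond (Equal 4 7)
         (Cond (Equal 6 7) (Seq (Move 9 1) (Seq (Move 10 2) (Move 11 7))) discover_root)
         discover_root)))"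

definition append_discovered :: com where
  "append_discovered = Seq (Write 2 12 9) (Seq (Write 3 12 10) (Seq (Write 1 9 7)
     (Cond (Equal 9 10) (Cond (Less 8 12) (Move 13 7) Skip) Skip)))"

definition compute_order :: com where
  "compute_order = Seq (Const 7 1)
     (For 12 (Seq (Const 11 0) (Seq (Scan discover) append_discovered)))"

definition clear :: com where
  "clear = Seq (For 1 (Seq (Write 4 1 8) (Seq (Write 5 1 8) (Write 6 1 8))))
     (Seq (Const 15 0) (Seq (Const 16 0) (Const 17 0)))"

text \<open>Colours are forced: opposite to the parent for a position in the matching, equal to the
  parent otherwise; a root, being its own parent, keeps the cleared colour 0. The same pass finds
  the last addable position: array 6 marks the ends of the matching edges named by earlier
  positions, so for a non-root outside the matching only the parent's mark matters.\<close>

definition colour_next :: com where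
  "colour_next = Seq (Read 1 2 12) (Seq (Read 2 3 12) (Seq (Read 19 7 12) (Seq (Read 5 4 2)
     (Cond (Equal 19 7)
       (Seq (Write 6 1 7) (Seq (Write 6 2 7) (Cond (Equal 5 7) (Write 4 1 8) (Write 4 1 7))))
       (Seq (Write 4 1 5) (Cond (Equal 1 2) Skip
         (Seq (Read 6 6 2) (Cond (Equal 6 7) Skip (Seq (Move 18 12) (Move 17 7))))))))))"

text \<open>Edges are met in both orientations, so conflicts are sought at the row vertex only,
  whereas the size is counted for one orientation.\<close>

definition check_entry :: com where
  "check_entry = Cond (Equal 4 7)
     (Seq (Read 5 4 1) (Seq (Read 6 4 2) (Cond (Equal 5 6) Skip
       (Seq (Read 5 5 1) (Seq (Cond (Equal 5 7) (Move 15 7) (Write 5 1 7))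
         (Cond (Less 1 2) (Inc 16) Skip)))))) Skip"

definition check_empty :: com where
  "check_empty = Cond (Equal 16 8) (Cond (Equal 13 7) Skip (Move 15 7)) Skip"

definition emit_entry :: com where
  "emit_entry = Cond (Equal 4 7) (Cond (Less 1 2)
     (Seq (Read 5 4 1) (Seq (Read 6 4 2) (Cond (Equal 5 6) Skip (Seq (Out 1) (Out 2))))) Skip) Skip"

text \<open>The code of an edge set starts with its size, known from \<open>check_entry\<close>;
  hence a second scan for the edges themselves.\<close>

definition emit :: com where
  "emit = Cond (Equal 15 7) Skip (Seq (Out 16) (Scan emit_entry))"

definition advance :: com where
  "advance = Cond (Equal 17 7)
     (Seq (For 12 (Cond (Less 18 12) (Write 7 12 8) Skip)) (Write 7 18 7)) (Move 14 7)"

definition process_matching :: com where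
  "process_matching = Seq clear (Seq (For 12 colour_next)
     (Seq (Scan check_entry) (Seq check_empty (Seq emit advance))))"

definition enumerate_cuts :: com where
  "enumerate_cuts = Seq compute_order (While (Equal 14 8) process_matching)"

lemmas program_defs = discover_root_def discover_def append_discovered_def clear_def
  colour_next_def check_entry_def check_empty_def emit_entry_def emit_def advance_def

definition ready :: "nat \<Rightarrow> nat set set \<Rightarrow> state \<Rightarrow> bool" where
  "ready n E s \<longleftrightarrow> reg s 0 = n \<and> reg s 7 = 1 \<and> reg s 8 = 0 \<and>
     (\<forall>u<n. \<forall>w<n. arr s 0 (u * n + w) = of_bool ({u, w} \<in> E))"

lemma ready_agree:
  "agree X Y b s s' \<Longrightarrow> ready n E s \<Longrightarrow> 0 \<notin> X \<Longrightarrow> 7 \<notin> X \<Longrightarrow> 8 \<notin> X \<Longrightarrow> 0 \<notin> Y \<Longrightarrow> ready n E s'"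
  by (simp add: ready_def agree_def)

lemma runs_discover:
  assumes r: "ready n E s" and f: "reg s 11 = 0"
    and marks: "\<And>v. v < n \<Longrightarrow> arr s 1 v = of_bool (v \<in> W)" and W: "W \<subseteq> {..<n}" "card W < n"
  shows "runs (Scan discover) s (scan_time n 10) (\<lambda>s'. reg s' 9 < n \<and> reg s' 9 \<notin> W \<and>
    (reg s' 10 \<in> W \<and> {reg s' 10, reg s' 9} \<in> E \<or>
     reg s' 10 = reg s' 9 \<and> (\<forall>u<n. \<forall>w\<in>W. u \<notin> W \<longrightarrow> {u, w} \<notin> E)))"
proof -
  define I where "I D s' \<longleftrightarrow>
    (reg s' 11 = 1 \<and> reg s' 9 < n \<and> reg s' 9 \<notin> W \<and> reg s' 10 \<in> W \<and> {reg s' 10, reg s' 9} \<in> E) \<or>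
    (reg s' 11 = 0 \<and> (\<forall>(u, w)\<in>D. u \<notin> W \<longrightarrow> w \<in> W \<longrightarrow> {u, w} \<notin> E) \<and>
      (\<forall>(u, w)\<in>D. u \<notin> W \<longrightarrow> reg s' 9 < n \<and> reg s' 9 \<notin> W \<and> reg s' 10 = reg s' 9))"
    for D and s' :: state
  have n: "reg s 0 = n" using r by (simp add: ready_def)
  have "runs (Scan discover) s (scan_time (reg s 0) 10) (I ({..<reg s 0} \<times> {..<reg s 0}))"
  proof (rule runs_Scan)
    show "I {} s" using f by (simp add: I_def)
  next
    fix D s' u w
    assume u: "u < reg s 0" "w < reg s 0" and D: "D \<subseteq> {..<reg s 0} \<times> {..<reg s 0}"
      and a: "agree ({1, 2, 3, 4} \<union> wregs discover) (warrs discover) (silent discover) s s'"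
      and s': "reg s' 1 = u" "reg s' 2 = w" "reg s' 4 = arr s 0 (u * reg s 0 + w)" and I: "I D s'"
    have 7: "reg s' 7 = 1" and 1: "arr s' 1 = arr s 1"
      using agree_reg[OF a, of 7] agree_arr[OF a, of 1] r by (simp_all add: program_defs ready_def)
    have e: "reg s' 4 = of_bool ({u, w} \<in> E)" using r u s'(3) by (simp add: ready_def)
    have uw: "u < n" "w < n" using u n by auto
    have m: "arr s' 1 u = of_bool (u \<in> W)" "arr s' 1 w = of_bool (w \<in> W)"
      using uw marks 1 by auto
    have "I (insert (u, w) D) (result discover s')"
    proof (cases "reg s' 11 = 1")
      case True
      with I have I': "reg s' 9 < n" "reg s' 9 \<notin> W" "reg s' 10 \<in> W" "{reg s' 10, reg s' 9} \<in> E"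
        by (auto simp: I_def)
      show ?thesis
        using True I' uw e 7 m s'(1,2)
        by (cases "u \<in> W"; cases "w \<in> W"; cases "{u, w} \<in> E")
          (simp_all add: program_defs I_def insert_commute)
    next
      case False
      with I have I': "reg s' 11 = 0" "\<forall>(u, w)\<in>D. u \<notin> W \<longrightarrow> w \<in> W \<longrightarrow> {u, w} \<notin> E"
        "\<forall>(u, w)\<in>D. u \<notin> W \<longrightarrow> reg s' 9 < n \<and> reg s' 9 \<notin> W \<and> reg s' 10 = reg s' 9"
        by (auto simp: I_def)
      show ?thesis
        using I' uw e 7 m s'(1,2)
        by (cases "u \<in> W"; cases "w \<in> W"; cases "{u, w} \<in> E")
          (simp_all add: program_defs I_def insert_commute)
    qed
    then show "runs discover s' 10 (I (insert (u, w) D))"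
      by (rule runs_loop_free[rotated]) (simp_all add: program_defs)
  next
    show "I D (set_reg x v s') = I D s'" if "x \<in> {1, 2, 3, 4}" for D s' x v
      using that by (elim insertE emptyE) (simp_all add: I_def)
  qed (simp_all add: program_defs)
  then show ?thesis
    unfolding n
  proof (rule runs_mono)
    fix s' assume I: "I ({..<n} \<times> {..<n}) s'"
    obtain v where v: "v < n" "v \<notin> W"
      using W by (metis card_lessThan lessThan_iff less_irrefl subsetI subset_antisym)
    \<comment> \<open>Any visited pair with an undiscovered row vertex has caused a choice, so one
      such pair shows that register 9 is set.\<close>
    then have vv: "(v, v) \<in> {..<n} \<times> {..<n}" by simp
    show "reg s' 9 < n \<and> reg s' 9 \<notin> W \<and> (reg s' 10 \<in> W \<and> {reg s' 10, reg s' 9} \<in> E \<or>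
        reg s' 10 = reg s' 9 \<and> (\<forall>u<n. \<forall>w\<in>W. u \<notin> W \<longrightarrow> {u, w} \<notin> E))"
    proof (cases "reg s' 11 = 1")
      case True
      with I show ?thesis by (simp add: I_def)
    next
      case False
      with I have I': "\<forall>(u, w)\<in>{..<n} \<times> {..<n}. u \<notin> W \<longrightarrow> w \<in> W \<longrightarrow> {u, w} \<notin> E"
        "\<forall>(u, w)\<in>{..<n} \<times> {..<n}. u \<notin> W \<longrightarrow> reg s' 9 < n \<and> reg s' 9 \<notin> W \<and> reg s' 10 = reg s' 9"
        by (simp_all add: I_def)
      have "reg s' 9 < n \<and> reg s' 9 \<notin> W \<and> reg s' 10 = reg s' 9" using bspec[OF I'(2) vv] v(2) by simp
      moreover have "{u, w} \<notin> E" if "u < n" "w \<in> W" "u \<notin> W" for u w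
        using bspec[OF I'(1), of "(u, w)"] that W(1) by auto
      ultimately show ?thesis by blast
    qed
  qed simp
qed

text \<open>\<open>par\<close> exists in the proof only: the memory holds parents as vertices, never
  as positions.\<close>

definition ordered_state :: "nat \<Rightarrow> nat set set \<Rightarrow> nat \<Rightarrow> (nat \<Rightarrow> nat) \<Rightarrow> state \<Rightarrow> bool" where
  "ordered_state n E k par s \<longleftrightarrow> search_order {..<n} E k (arr s 2) par \<and>
     (\<forall>j<k. arr s 3 j = arr s 2 (par j)) \<and>
     reg s 13 = of_bool (\<exists>r<k. 0 < r \<and> par r = r)"

lemma runs_append_discovered:
  assumes r: "ready n E s" and o: "ordered_state n E k par s" and k: "k < n" "reg s 12 = k"
    and marks: "\<And>v. v < n \<Longrightarrow> arr s 1 v = of_bool (v \<in> arr s 2 ` {..<k})"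
    and v: "reg s 9 < n" "reg s 9 \<notin> arr s 2 ` {..<k}"
      "reg s 10 \<in> arr s 2 ` {..<k} \<and> {reg s 10, reg s 9} \<in> E \<or>
       reg s 10 = reg s 9 \<and> (\<forall>u<n. \<forall>w\<in>arr s 2 ` {..<k}. u \<notin> arr s 2 ` {..<k} \<longrightarrow> {u, w} \<notin> E)"
  shows "runs append_discovered s 10 (\<lambda>s'. (\<exists>par. ordered_state n E (Suc k) par s') \<and>
    (\<forall>v<n. arr s' 1 v = of_bool (v \<in> arr s' 2 ` {..<Suc k})))"
proof (rule runs_loop_free)
  let ?o = "(arr s 2)(k := reg s 9)" and ?s = "result append_discovered s"
  have so: "search_order {..<n} E k (arr s 2) par" using o by (simp add: ordered_state_def)
  have par_le: "par j \<le> j" if "j < k" for j using so that by (auto simp: search_order_def)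
  have im: "?o ` {..<Suc k} = insert (reg s 9) (arr s 2 ` {..<k})"
    unfolding lessThan_Suc image_insert search_order_update(2) by simp
  have 2: "arr ?s 2 = ?o" "arr ?s 3 = (arr s 3)(k := reg s 10)" "arr ?s 1 = (arr s 1)(reg s 9 := 1)"
    "reg ?s 13 = (if reg s 9 = reg s 10 \<and> 0 < k then 1 else reg s 13)"
    using r k by (simp_all add: program_defs ready_def)
  \<comment> \<open>Recovers the position of the stored parent vertex. For a root this is
    \<open>k\<close> itself, where the new vertex has just been placed.\<close>
  have "\<exists>p. search_order {..<n} E (Suc k) ?o (par(k := p)) \<and> ?o p = reg s 10 \<and> p \<le> k \<and>
      (p = k \<longleftrightarrow> reg s 9 = reg s 10)"
    using v(3)
  proof
    assume a: "reg s 10 \<in> arr s 2 ` {..<k} \<and> {reg s 10, reg s 9} \<in> E"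
    then obtain p where p: "p < k" "reg s 10 = arr s 2 p" by auto
    then show ?thesis using search_order_child[OF so, of "reg s 9" p] a v(1,2) by auto
  next
    assume a: "reg s 10 = reg s 9 \<and> (\<forall>u<n. \<forall>w\<in>arr s 2 ` {..<k}. u \<notin> arr s 2 ` {..<k} \<longrightarrow> {u, w} \<notin> E)"
    then have "{arr s 2 i, w} \<notin> E" if "i < k" "w \<in> {..<n} - arr s 2 ` {..<k}" for i w
      using that by (subst insert_commute) auto
    then show ?thesis using search_order_root[OF so, of "reg s 9"] a v(1,2) by auto
  qed
  then obtain p where p: "search_order {..<n} E (Suc k) ?o (par(k := p))" "?o p = reg s 10" "p \<le> k"
      "p = k \<longleftrightarrow> reg s 9 = reg s 10" by blast
  have "arr ?s 3 j = ?o ((par(k := p)) j)" if "j < Suc k" for j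
  proof (cases "j = k")
    case False
    then have "j < k" "par j \<noteq> k" using that par_le[of j] by auto
    then show ?thesis using o 2 by (simp add: ordered_state_def)
  qed (use p 2 in auto)
  moreover have "(\<exists>r<Suc k. 0 < r \<and> (par(k := p)) r = r) \<longleftrightarrow> (\<exists>r<k. 0 < r \<and> par r = r) \<or> 0 < k \<and> p = k"
    by (auto simp: less_Suc_eq)
  then have "reg ?s 13 = of_bool (\<exists>r<Suc k. 0 < r \<and> (par(k := p)) r = r)"
    using o 2(4) p(4) by (auto simp: ordered_state_def)
  ultimately have "ordered_state n E (Suc k) (par(k := p)) ?s"
    using p(1) 2(1) by (simp add: ordered_state_def)
  moreover have "\<forall>v<n. arr ?s 1 v = of_bool (v \<in> arr ?s 2 ` {..<Suc k})"
    unfolding 2(1,3) im using marks by auto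
  ultimately show "(\<exists>par. ordered_state n E (Suc k) par ?s) \<and>
    (\<forall>v<n. arr ?s 1 v = of_bool (v \<in> arr ?s 2 ` {..<Suc k}))" by blast
qed (auto simp: program_defs)

definition order_time :: "nat \<Rightarrow> nat" where
  "order_time n = n * (scan_time n 10 + 13) + 3"

lemma runs_compute_order:
  assumes r: "ready n E (set_reg 7 1 s)" and s: "reg s 13 = 0" "\<And>v. arr s 1 v = 0"
  shows "runs compute_order s (order_time n)
    (\<lambda>s'. ready n E s' \<and> (\<exists>par. ordered_state n E n par s'))"
proof -
  let ?s = "set_reg 7 1 s" and ?b = "Seq (Const 11 0) (Seq (Scan discover) append_discovered)"
  have n: "reg ?s 0 = n" using r by (simp add: ready_def)
  define I where "I k s' \<longleftrightarrow> (\<exists>par. ordered_state n E k par s') \<and>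
    (\<forall>v<n. arr s' 1 v = of_bool (v \<in> arr s' 2 ` {..<k}))" for k s'
  have I_reg: "I k (set_reg 12 v s') = I k s'" for k v s' by (simp add: I_def ordered_state_def)
  have "runs (For 12 ?b) ?s (reg ?s 0 * (scan_time n 10 + 11 + 2) + 2) (\<lambda>s'. I (reg ?s 0) s')"
  proof (rule runs_For)
    show "I 0 (set_reg 12 0 ?s)"
      unfolding I_reg using s by (simp add: I_def ordered_state_def search_order_def)
  next
    fix k s' assume k: "k < reg ?s 0" and I: "I k s'" and k': "reg s' 12 = k"
      and a: "agree (insert 12 (wregs ?b)) (warrs ?b) (silent ?b) ?s s'"
    let ?t = "set_reg 11 0 s'" and ?W = "arr s' 2 ` {..<k}"
    have r': "ready n E ?t"
      using ready_agree[OF a r] by (simp add: program_defs ready_def)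
    obtain par where o: "ordered_state n E k par s'" and marks: "\<forall>v<n. arr s' 1 v = of_bool (v \<in> ?W)"
      using I unfolding I_def by blast
    have W: "?W \<subseteq> {..<n}" using o by (simp add: ordered_state_def search_order_def)
    have "card ?W < n" using card_image_le[of "{..<k}" "arr s' 2"] k n by simp
    from runs_frame[OF runs_discover[OF r' _ _ W this]] marks
    have "runs (Scan discover) ?t (scan_time n 10) (\<lambda>s''. frame (Scan discover) ?t s'' \<and>
      reg s'' 9 < n \<and> reg s'' 9 \<notin> ?W \<and> (reg s'' 10 \<in> ?W \<and> {reg s'' 10, reg s'' 9} \<in> E \<or>
      reg s'' 10 = reg s'' 9 \<and> (\<forall>u<n. \<forall>w\<in>?W. u \<notin> ?W \<longrightarrow> {u, w} \<notin> E)))" by simp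
    then have "runs (Scan discover) ?t (scan_time n 10) (\<lambda>s''. runs append_discovered s'' 10
      (\<lambda>s''. I (Suc k) (set_reg 12 (Suc k) s'')))"
    proof (rule runs_mono)
      fix s'' assume *: "frame (Scan discover) ?t s'' \<and>
        reg s'' 9 < n \<and> reg s'' 9 \<notin> ?W \<and> (reg s'' 10 \<in> ?W \<and> {reg s'' 10, reg s'' 9} \<in> E \<or>
        reg s'' 10 = reg s'' 9 \<and> (\<forall>u<n. \<forall>w\<in>?W. u \<notin> ?W \<longrightarrow> {u, w} \<notin> E))"
      then have fr: "frame (Scan discover) ?t s''" by blast
      have arrs: "arr s'' a = arr s' a" for a
        using agree_arr[OF fr, of a] by (simp add: program_defs)
      have regs: "reg s'' 12 = k" "reg s'' 13 = reg s' 13"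
        using agree_reg[OF fr, of 12] agree_reg[OF fr, of 13] k' by (simp_all add: program_defs)
      have "runs append_discovered s'' 10 (\<lambda>s'. (\<exists>par. ordered_state n E (Suc k) par s') \<and>
        (\<forall>v<n. arr s' 1 v = of_bool (v \<in> arr s' 2 ` {..<Suc k})))"
      proof (rule runs_append_discovered)
        show "ready n E s''" using ready_agree[OF fr r'] by (simp add: program_defs)
        show "ordered_state n E k par s''" using o by (simp add: ordered_state_def arrs regs)
      qed (use * k n marks in \<open>simp_all add: arrs regs\<close>)
      then show "runs append_discovered s'' 10 (\<lambda>s''. I (Suc k) (set_reg 12 (Suc k) s''))"
        unfolding I_reg unfolding I_def .
    qed simp
    from runs_Seq[OF this]
    have "runs (Seq (Scan discover) append_discovered) ?t (scan_time n 10 + 10)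
      (\<lambda>s''. I (Suc k) (set_reg 12 (Suc k) s''))" .
    then show "runs ?b s' (scan_time n 10 + 11) (\<lambda>s''. I (Suc k) (set_reg 12 (Suc k) s''))"
      by - (rule runs_Seq_loop_free[where u = "scan_time n 10 + 10"]; simp)
  qed (auto simp: program_defs)
  from runs_frame[OF this] have "runs (For 12 ?b) ?s (n * (scan_time n 10 + 13) + 2)
    (\<lambda>s'. ready n E s' \<and> (\<exists>par. ordered_state n E n par s'))"
    unfolding n
  proof (rule runs_mono)
    fix s' assume *: "frame (For 12 ?b) ?s s' \<and> I n s'"
    then have "frame (For 12 ?b) ?s s'" by blast
    then have "ready n E s'" by (rule ready_agree[OF _ r]) (simp_all add: program_defs)
    then show "ready n E s' \<and> (\<exists>par. ordered_state n E n par s')" using * by (simp add: I_def)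
  qed simp
  then show ?thesis unfolding compute_order_def order_time_def
    by - (rule runs_Seq_loop_free[where u = "n * (scan_time n 10 + 13) + 2"]; simp)
qed

section \<open>One round: colouring, testing and writing a cut\<close>

definition emit_time :: "nat \<Rightarrow> nat" where
  "emit_time n = scan_time n 10 + 5"

locale enumeration = search_ordered "{..<n}" E n ord par
  for n :: nat and E ord par
begin

definition static :: "state \<Rightarrow> bool" where
  "static s \<longleftrightarrow> ready n E s \<and> (\<forall>j<n. arr s 2 j = ord j \<and> arr s 3 j = ord (par j)) \<and>
     reg s 13 = of_bool (\<exists>r<n. 0 < r \<and> par r = r)"

definition bits :: "nat set \<Rightarrow> state \<Rightarrow> bool" where
  "bits X s \<longleftrightarrow> (\<forall>j<n. arr s 7 j = of_bool (j \<in> X))"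

definition binary :: "(nat \<Rightarrow> nat) \<Rightarrow> bool" where
  "binary c \<longleftrightarrow> (\<forall>v<n. c v = 0 \<or> c v = 1)"

definition colour_class :: "(nat \<Rightarrow> nat) \<Rightarrow> nat set" where
  "colour_class c = {v. v < n \<and> c v = 1}"

definition cut_of :: "(nat \<Rightarrow> nat) \<Rightarrow> nat set set" where
  "cut_of c = edges_between E (colour_class c) ({..<n} - colour_class c)"

definition candidate :: "nat set \<Rightarrow> nat \<Rightarrow> state \<Rightarrow> bool" where
  "candidate X k s \<longleftrightarrow> (reg s 17 = 0 \<and> (\<forall>i<k. \<not> addable par X i)) \<or>
     (reg s 17 = 1 \<and> reg s 18 < k \<and> addable par X (reg s 18) \<and>
       (\<forall>i<k. reg s 18 < i \<longrightarrow> \<not> addable par X i))"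

lemma static_agree:
  "agree X Y b s s' \<Longrightarrow> static s \<Longrightarrow> X \<inter> {0, 7, 8, 13} = {} \<Longrightarrow> Y \<inter> {0, 2, 3} = {} \<Longrightarrow> static s'"
  by (auto simp: static_def ready_def agree_def)

lemma edge_less: "{u, w} \<in> E \<Longrightarrow> u < n \<and> w < n \<and> u \<noteq> w"
  using simple by (auto simp: simple_graph_def)

lemma colour_class_subset: "colour_class c \<subseteq> {..<n}"
  by (auto simp: colour_class_def)

lemma binary_neq: "binary c \<Longrightarrow> u < n \<Longrightarrow> w < n \<Longrightarrow> (c u = 1) \<noteq> (c w = 1) \<longleftrightarrow> c u \<noteq> c w"
  unfolding binary_def by (metis zero_neq_one)

lemma cut_of_iff: "binary c \<Longrightarrow> {u, w} \<in> cut_of c \<longleftrightarrow> {u, w} \<in> E \<and> c u \<noteq> c w"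
proof (cases "{u, w} \<in> E")
  case True
  assume "binary c"
  then show ?thesis
    using edges_between_iff[OF simple colour_class_subset[of c] True] edge_less[OF True] True
      binary_neq[of c u w] by (simp add: cut_of_def colour_class_def)
next
  case False
  then show ?thesis using edges_between_subset[of E] by (auto simp: cut_of_def)
qed

lemma cut_of_subset: "cut_of c \<subseteq> E"
  by (simp add: cut_of_def edges_between_subset)

lemma forest_part_cut_of:
  assumes "binary c"
  shows "forest_part (cut_of c) = {j. j < n \<and> c (ord j) \<noteq> c (ord (par j))}"
proof -
  have "ord j < n \<and> ord (par j) < n" if "j < n" for j
    using ord_in[of j] ord_in[of "par j"] par_le[of j] that by auto
  then show ?thesis
    using binary_neq[OF assms] unfolding cut_of_def forest_part_edges_between[OF colour_class_subset]
    by (auto simp: colour_class_def)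
qed

lemma runs_clear:
  assumes "static s"
  shows "runs clear s (n * 5 + 5) (\<lambda>s'. (\<forall>v<n. arr s' 4 v = 0 \<and> arr s' 5 v = 0 \<and> arr s' 6 v = 0) \<and>
    reg s' 15 = 0 \<and> reg s' 16 = 0 \<and> reg s' 17 = 0)"
proof -
  let ?b = "Seq (Write 4 1 8) (Seq (Write 5 1 8) (Write 6 1 8))"
  define I where "I k s' \<longleftrightarrow> (\<forall>v<k. arr s' 4 v = 0 \<and> arr s' 5 v = 0 \<and> arr s' 6 v = 0)"
    for k and s' :: state
  have n: "reg s 0 = n" and 8: "reg s 8 = 0" using assms by (simp_all add: static_def ready_def)
  have "runs (For 1 ?b) s (reg s 0 * (3 + 2) + 2) (\<lambda>s'. I (reg s 0) s')"
  proof (rule runs_For)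
    fix k s' assume a: "agree (insert 1 (wregs ?b)) (warrs ?b) (silent ?b) s s'"
      and k: "reg s' 1 = k" and I: "I k s'"
    have "reg s' 8 = 0" using agree_reg[OF a, of 8] 8 by simp
    then have "I (Suc k) (set_reg 1 (Suc k) (result ?b s'))"
      using I k by (simp add: I_def less_Suc_eq)
    then show "runs ?b s' 3 (\<lambda>s''. I (Suc k) (set_reg 1 (Suc k) s''))"
      by (rule runs_loop_free[rotated]) simp_all
  qed (simp_all add: I_def)
  then have "runs (For 1 ?b) s (n * 5 + 2) (\<lambda>s'. runs (Seq (Const 15 0) (Seq (Const 16 0) (Const 17 0))) s' 3
    (\<lambda>s'. (\<forall>v<n. arr s' 4 v = 0 \<and> arr s' 5 v = 0 \<and> arr s' 6 v = 0) \<and>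
    reg s' 15 = 0 \<and> reg s' 16 = 0 \<and> reg s' 17 = 0))"
    unfolding n by (rule runs_mono) (auto simp: I_def intro!: runs_loop_free)
  from runs_Seq[OF this] show ?thesis unfolding clear_def by (rule runs_mono) simp_all
qed

lemma runs_colour:
  assumes s: "static s" "bits X s" and X: "X \<in> forest_matchings par {..<n}"
    and clear: "\<And>v. v < n \<Longrightarrow> arr s 4 v = 0" "\<And>v. v < n \<Longrightarrow> arr s 6 v = 0" "reg s 17 = 0"
  shows "runs (For 12 colour_next) s (n * 18 + 2) (\<lambda>s'. binary (arr s' 4) \<and>
    (\<forall>i<n. arr s' 4 (ord i) \<noteq> arr s' 4 (ord (par i)) \<longleftrightarrow> i \<in> X) \<and> candidate X n s')"
proof -
  define I where "I k s' \<longleftrightarrow> binary (arr s' 4) \<and>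
    (\<forall>i<k. arr s' 4 (ord i) \<noteq> arr s' 4 (ord (par i)) \<longleftrightarrow> i \<in> X) \<and>
    (\<forall>i<n. arr s' 6 (ord i) = of_bool (\<exists>j\<in>X. j < k \<and> (i = j \<or> i = par j))) \<and> candidate X k s'"
    for k s'
  have n: "reg s 0 = n" using s(1) by (simp add: static_def ready_def)
  have lt: "ord i < n" if "i < n" for i using ord_in[OF that] by simp
  have "runs (For 12 colour_next) s (reg s 0 * (16 + 2) + 2) (\<lambda>s'. I (reg s 0) s')"
  proof (rule runs_For)
    show "I 0 (set_reg 12 0 s)" using clear lt by (simp add: I_def binary_def candidate_def)
  next
    fix k s' assume k: "k < reg s 0" and k': "reg s' 12 = k" and I: "I k s'"
      and a: "agree (insert 12 (wregs colour_next)) (warrs colour_next) (silent colour_next) s s'"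
    have kn: "k < n" using k n by simp
    have st: "static s'" by (rule static_agree[OF a s(1)]) (simp_all add: program_defs)
    have bit: "arr s' 7 k = of_bool (k \<in> X)"
      using agree_arr[OF a, of 7] s(2) kn by (simp add: bits_def program_defs)
    have cs: "reg s' 7 = 1" "reg s' 8 = 0" "arr s' 2 k = ord k" "arr s' 3 k = ord (par k)"
      using st kn by (simp_all add: static_def ready_def)
    let ?u = "ord k" and ?w = "ord (par k)" and ?r = "result colour_next s'"
    let ?c = "arr s' 4"
    have par_k: "par k \<le> k" "par k < n" using par_le[OF kn] kn by auto
    have uw: "?u = ?w \<longleftrightarrow> par k = k" using inj_ord[of k "par k"] par_k kn by auto
    have bin: "binary ?c" using I by (simp add: I_def)
    then have cw: "?c ?w = 0 \<or> ?c ?w = 1" using lt par_k by (simp add: binary_def)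
    have X_par: "k \<in> X \<Longrightarrow> par k < k" using X by (auto simp: forest_matchings_def)
    have cov: "arr s' 6 (ord i) = of_bool (\<exists>j\<in>X. j < k \<and> (i = j \<or> i = par j))" if "i < n" for i
      using I that unfolding I_def by blast
    have c': "arr ?r 4 = ?c(?u := if k \<in> X then 1 - ?c ?w else ?c ?w)"
      using cw by (elim disjE; cases "k \<in> X") (simp_all add: program_defs bit cs k')
    have "arr ?r 6 = (if k \<in> X then (arr s' 6)(?u := 1, ?w := 1) else arr s' 6)"
      using bit cs k' by (simp add: program_defs)
    then have "arr ?r 6 (ord i) = (if k \<in> X \<and> (i = k \<or> i = par k) then 1 else arr s' 6 (ord i))"
      if "i < n" for i
      using inj_ord[OF that kn] inj_ord[OF that par_k(2)] by simp
    moreover have "(\<exists>j\<in>X. j < Suc k \<and> (i = j \<or> i = par j)) \<longleftrightarrow>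
        (\<exists>j\<in>X. j < k \<and> (i = j \<or> i = par j)) \<or> k \<in> X \<and> (i = k \<or> i = par k)" for i
      unfolding less_Suc_eq by blast
    ultimately have cov': "arr ?r 6 (ord i) = of_bool (\<exists>j\<in>X. j < Suc k \<and> (i = j \<or> i = par j))"
      if "i < n" for i
      using cov[OF that] that by simp
    have "par k < k \<longleftrightarrow> par k \<noteq> k" using par_k(1) by linarith
    \<comment> \<open>An unmarked parent means that no earlier element of \<open>X\<close> equals
      \<open>par k\<close> or shares that parent, which is the conflict condition of
      \<open>addable\<close>.\<close>
    then have add_iff: "addable par X k \<longleftrightarrow> k \<notin> X \<and> ?u \<noteq> ?w \<and> arr s' 6 ?w = 0"
      unfolding addable_def uw cov[OF par_k(2)] of_bool_eq_0_iff by blast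
    have regs: "reg ?r 17 = (if addable par X k then 1 else reg s' 17)"
      "reg ?r 18 = (if addable par X k then k else reg s' 18)"
      using bit cs k' cov[OF par_k(2)] unfolding add_iff by (auto simp: program_defs)
    have "candidate X (Suc k) ?r"
    proof (cases "addable par X k")
      case True
      then show ?thesis using regs by (simp add: candidate_def)
    next
      case False
      then have "reg ?r 17 = reg s' 17" "reg ?r 18 = reg s' 18" using regs by simp_all
      moreover have "candidate X k s'" using I by (simp add: I_def)
      ultimately show ?thesis using False unfolding candidate_def by (auto simp: less_Suc_eq)
    qed
    moreover have "binary (arr ?r 4)"
      using bin cw unfolding c' by (auto simp: binary_def)
    moreover have "arr ?r 4 (ord i) \<noteq> arr ?r 4 (ord (par i)) \<longleftrightarrow> i \<in> X" if "i < Suc k" for i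
    proof (cases "i = k")
      case True
      show ?thesis
      proof (cases "par k = k")
        case True
        then show ?thesis using X_par \<open>i = k\<close> by auto
      next
        case False
        then show ?thesis using uw cw \<open>i = k\<close> unfolding c' by auto
      qed
    next
      case False
      then have "i < k" using that by simp
      then have "par i < k" using par_le[of i] kn by simp
      then have "ord i \<noteq> ?u" "ord (par i) \<noteq> ?u"
        using inj_ord[of i k] inj_ord[of "par i" k] \<open>i < k\<close> kn by auto
      moreover have "?c (ord i) \<noteq> ?c (ord (par i)) \<longleftrightarrow> i \<in> X" using I \<open>i < k\<close> unfolding I_def by blast
      ultimately show ?thesis unfolding c' by simp
    qed
    ultimately have "I (Suc k) ?r" using cov' unfolding I_def by blast
    then have "I (Suc k) (set_reg 12 (Suc k) ?r)" by (simp add: I_def candidate_def)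
    then show "runs colour_next s' 16 (\<lambda>s''. I (Suc k) (set_reg 12 (Suc k) s''))"
      by (rule runs_loop_free[rotated]) (simp_all add: program_defs)
  qed (simp_all add: program_defs)
  then show ?thesis unfolding n by (rule runs_mono) (auto simp: I_def)
qed

lemma runs_check:
  assumes s: "static s" "binary (arr s 4)" and clear: "\<And>v. v < n \<Longrightarrow> arr s 5 v = 0"
      "reg s 15 = 0" "reg s 16 = 0"
  shows "runs (Scan check_entry) s (scan_time n 15) (\<lambda>s'.
    reg s' 15 = of_bool (\<not> matching E (cut_of (arr s 4))) \<and>
    reg s' 16 = card (oriented_edges (cut_of (arr s 4))))"
proof -
  let ?c = "arr s 4"
  define C where "C = cut_of ?c"
  define I where "I D s' \<longleftrightarrow>
    (\<forall>u<n. arr s' 5 u = of_bool (\<exists>w. (u, w) \<in> D \<and> {u, w} \<in> C)) \<and>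
    reg s' 15 = of_bool (\<exists>u w w'. (u, w) \<in> D \<and> (u, w') \<in> D \<and> w \<noteq> w' \<and> {u, w} \<in> C \<and> {u, w'} \<in> C) \<and>
    reg s' 16 = card (D \<inter> oriented_edges C)" for D and s' :: state
  have n: "reg s 0 = n" using s(1) by (simp add: static_def ready_def)
  have "runs (Scan check_entry) s (scan_time (reg s 0) 15) (I ({..<reg s 0} \<times> {..<reg s 0}))"
  proof (rule runs_Scan)
    show "I {} s" using clear by (simp add: I_def)
    show "I D (set_reg x v s') = I D s'" if "x \<in> {1, 2, 3, 4}" for D s' x v
      using that by (elim insertE emptyE) (simp_all add: I_def)
  next
    fix D s' u w
    assume u: "u < reg s 0" "w < reg s 0" "(u, w) \<notin> D" and D: "D \<subseteq> {..<reg s 0} \<times> {..<reg s 0}"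
      and a: "agree ({1, 2, 3, 4} \<union> wregs check_entry) (warrs check_entry) (silent check_entry) s s'"
      and s': "reg s' 1 = u" "reg s' 2 = w" "reg s' 4 = arr s 0 (u * reg s 0 + w)" and I: "I D s'"
    have cs: "reg s' 7 = 1" "arr s' 4 = ?c"
      using agree_reg[OF a, of 7] agree_arr[OF a, of 4] s(1)
      by (simp_all add: program_defs static_def ready_def)
    have e: "reg s' 4 = of_bool ({u, w} \<in> E)"
      using s(1) u s'(3) by (simp add: static_def ready_def)
    have C: "{u, w} \<in> C \<longleftrightarrow> {u, w} \<in> E \<and> ?c u \<noteq> ?c w" unfolding C_def by (rule cut_of_iff[OF s(2)])
    let ?r = "result check_entry s'"
    have "I (insert (u, w) D) ?r"
    proof (cases "{u, w} \<in> C")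
      case False
      then have r: "arr ?r 5 = arr s' 5" "reg ?r 15 = reg s' 15" "reg ?r 16 = reg s' 16"
        using C e cs s' by (auto simp: program_defs)
      have "insert (u, w) D \<inter> oriented_edges C = D \<inter> oriented_edges C"
        using False by (auto simp: oriented_edges_def)
      moreover have "(\<exists>w'. (u', w') \<in> insert (u, w) D \<and> {u', w'} \<in> C) \<longleftrightarrow>
          (\<exists>w'. (u', w') \<in> D \<and> {u', w'} \<in> C)" for u'
        using False by blast
      moreover have "(\<exists>u' w1 w2. (u', w1) \<in> insert (u, w) D \<and> (u', w2) \<in> insert (u, w) D \<and> w1 \<noteq> w2 \<and>
          {u', w1} \<in> C \<and> {u', w2} \<in> C) \<longleftrightarrow>
        (\<exists>u' w1 w2. (u', w1) \<in> D \<and> (u', w2) \<in> D \<and> w1 \<noteq> w2 \<and> {u', w1} \<in> C \<and> {u', w2} \<in> C)"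
        using False by blast
      ultimately show ?thesis using I unfolding I_def r by presburger
    next
      case True
      \<comment> \<open>Whether the row vertex already lies on a cut edge. As the pair
        \<open>(u, w)\<close> is new, the earlier neighbour differs from \<open>w\<close>, so a
        second edge at \<open>u\<close> breaks the matching.\<close>
      define deg where "deg \<longleftrightarrow> (\<exists>w. (u, w) \<in> D \<and> {u, w} \<in> C)"
      have un: "u < n" using u n by simp
      then have deg: "arr s' 5 u = of_bool deg" using I by (simp add: I_def deg_def)
      have r: "arr ?r 5 = (arr s' 5)(u := 1)" "reg ?r 15 = (if deg then 1 else reg s' 15)"
        "reg ?r 16 = (if u < w then reg s' 16 + 1 else reg s' 16)"
        using True C e cs s' deg by (auto simp: program_defs)
      have "\<forall>u'<n. arr ?r 5 u' = of_bool (\<exists>w'. (u', w') \<in> insert (u, w) D \<and> {u', w'} \<in> C)"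
        using I True unfolding I_def r by auto
      moreover have "(\<exists>u' w1 w2. (u', w1) \<in> insert (u, w) D \<and> (u', w2) \<in> insert (u, w) D \<and> w1 \<noteq> w2 \<and>
          {u', w1} \<in> C \<and> {u', w2} \<in> C) \<longleftrightarrow> deg \<or>
        (\<exists>u' w1 w2. (u', w1) \<in> D \<and> (u', w2) \<in> D \<and> w1 \<noteq> w2 \<and> {u', w1} \<in> C \<and> {u', w2} \<in> C)"
        (is "?P \<longleftrightarrow> deg \<or> ?Q")
      proof
        assume ?P
        then show "deg \<or> ?Q" unfolding deg_def by blast
      next
        assume "deg \<or> ?Q"
        then show ?P
        proof
          assume deg
          then obtain w' where "(u, w') \<in> D" "{u, w'} \<in> C" unfolding deg_def by blast
          moreover from this have "w \<noteq> w'" using u(3) by blast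
          ultimately show ?P using True by blast
        qed blast
      qed
      then have "reg ?r 15 = of_bool ?P" using I unfolding I_def r by simp
      moreover have "reg ?r 16 = card (insert (u, w) D \<inter> oriented_edges C)"
      proof (cases "u < w")
        case True
        then have "insert (u, w) D \<inter> oriented_edges C = insert (u, w) (D \<inter> oriented_edges C)"
          using \<open>{u, w} \<in> C\<close> by (auto simp: oriented_edges_def)
        moreover have "finite D" using D finite_subset by blast
        ultimately show ?thesis using I u(3) True unfolding I_def r by simp
      next
        case False
        then have "insert (u, w) D \<inter> oriented_edges C = D \<inter> oriented_edges C"
          by (auto simp: oriented_edges_def)
        then show ?thesis using I False unfolding I_def r by simp
      qed
      ultimately show ?thesis unfolding I_def by blast
    qed
    then show "runs check_entry s' 15 (I (insert (u, w) D))"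
      by (rule runs_loop_free[rotated]) (simp_all add: program_defs)
  qed (simp_all add: program_defs)
  then show ?thesis unfolding n
  proof (rule runs_mono)
    fix s' assume I: "I ({..<n} \<times> {..<n}) s'"
    have lt: "u < n \<and> w < n" if "{u, w} \<in> C" for u w
      using that cut_of_subset edge_less unfolding C_def by blast
    then have "(\<exists>u w w'. (u, w) \<in> {..<n} \<times> {..<n} \<and> (u, w') \<in> {..<n} \<times> {..<n} \<and> w \<noteq> w' \<and>
        {u, w} \<in> C \<and> {u, w'} \<in> C) \<longleftrightarrow> \<not> matching E C"
      unfolding matching_iff_degree[OF simple cut_of_subset[of ?c], folded C_def] mem_Sigma_iff lessThan_iff
      by blast
    moreover have "({..<n} \<times> {..<n}) \<inter> oriented_edges C = oriented_edges C"
      using lt by (auto simp: oriented_edges_def)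
    ultimately show "reg s' 15 = of_bool (\<not> matching E (cut_of ?c)) \<and>
      reg s' 16 = card (oriented_edges (cut_of ?c))"
      using I unfolding I_def C_def by simp
  qed simp
qed

text \<open>A nonempty cut has two nonempty sides, so being a matching decides. The empty set is
  always a matching, but a cut only if a second root exists, which register 13 records.\<close>

lemma runs_check_empty:
  assumes s: "static s" "binary (arr s 4)"
    and r: "reg s 15 = of_bool (\<not> matching E (cut_of (arr s 4)))"
      "reg s 16 = card (oriented_edges (cut_of (arr s 4)))"
  shows "runs check_empty s 5 (\<lambda>s'.
    reg s' 15 = of_bool (cut_of (arr s 4) \<notin> matching_cuts {..<n} E))"
proof -
  let ?C = "cut_of (arr s 4)"
  have "oriented_edges ?C \<subseteq> {..<n} \<times> {..<n}"
    using edge_less cut_of_subset by (auto simp: oriented_edges_def)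
  then have "finite (oriented_edges ?C)" using finite_subset by blast
  then have 0: "reg s 16 = 0 \<longleftrightarrow> ?C = {}"
    using r(2) image_oriented_edges[OF simple cut_of_subset, of "arr s 4"]
    by (auto simp: oriented_edges_def)
  have all: "?C \<in> all_cuts {..<n} E \<longleftrightarrow> matching E ?C"
    using colour_class_subset unfolding all_cuts_def cut_of_def by blast
  have "reg (result check_empty s) 15 = of_bool (?C \<notin> matching_cuts {..<n} E)"
  proof (cases "?C = {}")
    case True
    have "matching E ?C" unfolding True by (simp add: matching_def)
    moreover have "reg s 13 = of_bool (?C \<in> matching_cuts {..<n} E)"
      using s(1) empty_matching_cut unfolding True by (simp add: static_def)
    moreover have "reg s 7 = 1" "reg s 8 = 0" using s(1) by (simp_all add: static_def ready_def)
    moreover have "reg s 16 = 0" using 0 True by simp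
    ultimately show ?thesis
      using r(1) by (cases "?C \<in> matching_cuts {..<n} E") (simp_all add: program_defs)
  next
    case False
    then have "?C \<in> matching_cuts {..<n} E \<longleftrightarrow> matching E ?C"
      using nonempty_all_cuts matching_cuts_subset all by blast
    then show ?thesis using False s(1) r(1) 0 by (simp add: program_defs static_def ready_def)
  qed
  then show ?thesis by (rule runs_loop_free[rotated]) (simp_all add: program_defs)
qed

lemma runs_emit:
  assumes s: "static s" "binary (arr s 4)" and m: "reg s 16 = card (oriented_edges (cut_of (arr s 4)))"
  shows "runs emit s (emit_time n) (\<lambda>s'. if reg s 15 = 1 then out s' = out s else
    \<exists>es. distinct es \<and> set es = oriented_edges (cut_of (arr s 4)) \<and> out s' = out s @ edge_code es)"
proof -
  let ?c = "arr s 4" and ?s = "s\<lparr>out := out s @ [reg s 16]\<rparr>"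
  let ?code = "\<lambda>es. concat (map (\<lambda>(u, v). [u, v]) es) :: nat list"
  define C where "C = cut_of ?c"
  define I where "I D s' \<longleftrightarrow> (\<exists>es. distinct es \<and> set es = D \<inter> oriented_edges C \<and>
    out s' = out ?s @ ?code es)" for D and s' :: state
  have n: "reg ?s 0 = n" using s(1) by (simp add: static_def ready_def)
  have "runs (Scan emit_entry) ?s (scan_time (reg ?s 0) 10) (I ({..<reg ?s 0} \<times> {..<reg ?s 0}))"
  proof (rule runs_Scan)
    show "I {} ?s" by (simp add: I_def)
    show "I D (set_reg x v s') = I D s'" if "x \<in> {1, 2, 3, 4}" for D s' x v
      by (simp add: I_def)
  next
    fix D s' u w
    assume u: "u < reg ?s 0" "w < reg ?s 0" "(u, w) \<notin> D"
      and a: "agree ({1, 2, 3, 4} \<union> wregs emit_entry) (warrs emit_entry) (silent emit_entry) ?s s'"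
      and s': "reg s' 1 = u" "reg s' 2 = w" "reg s' 4 = arr ?s 0 (u * reg ?s 0 + w)" and I: "I D s'"
    have cs: "reg s' 7 = 1" "arr s' 4 = ?c"
      using agree_reg[OF a, of 7] agree_arr[OF a, of 4] s(1)
      by (simp_all add: program_defs static_def ready_def)
    have e: "reg s' 4 = of_bool ({u, w} \<in> E)"
      using s(1) u s'(3) by (simp add: static_def ready_def)
    have C: "{u, w} \<in> C \<longleftrightarrow> {u, w} \<in> E \<and> ?c u \<noteq> ?c w" unfolding C_def by (rule cut_of_iff[OF s(2)])
    obtain es where es: "distinct es" "set es = D \<inter> oriented_edges C" "out s' = out ?s @ ?code es"
      using I by (auto simp: I_def)
    have "I (insert (u, w) D) (result emit_entry s')"
    proof (cases "(u, w) \<in> oriented_edges C")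
      case True
      then have "out (result emit_entry s') = out ?s @ ?code (es @ [(u, w)])"
        using C e cs s' es(3) by (simp add: program_defs oriented_edges_def)
      moreover have "distinct (es @ [(u, w)])" "set (es @ [(u, w)]) = insert (u, w) D \<inter> oriented_edges C"
        using es u(3) True by auto
      ultimately show ?thesis unfolding I_def by blast
    next
      case False
      then have "out (result emit_entry s') = out ?s @ ?code es"
        using C e cs s' es(3) by (auto simp: program_defs oriented_edges_def)
      moreover have "set es = insert (u, w) D \<inter> oriented_edges C" using es False by auto
      ultimately show ?thesis using es(1) unfolding I_def by blast
    qed
    then show "runs emit_entry s' 10 (I (insert (u, w) D))"
      by (rule runs_loop_free[rotated]) (simp_all add: program_defs)
  qed (simp_all add: program_defs)
  then have scan: "runs (Scan emit_entry) ?s (scan_time n 10) (I ({..<n} \<times> {..<n}))" unfolding n .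
  have "runs (Seq (Out 16) (Scan emit_entry)) s (scan_time n 10 + 1) (I ({..<n} \<times> {..<n}))"
    using scan by - (rule runs_Seq_loop_free[where u = "scan_time n 10"]; simp)
  moreover have "({..<n} \<times> {..<n}) \<inter> oriented_edges C = oriented_edges C"
    using edge_less cut_of_subset unfolding C_def by (auto simp: oriented_edges_def)
  ultimately have 1: "runs (Seq (Out 16) (Scan emit_entry)) s (scan_time n 10 + 1)
    (\<lambda>s'. \<exists>es. distinct es \<and> set es = oriented_edges C \<and> out s' = out s @ edge_code es)"
  proof (elim runs_mono)
    fix s' assume o: "({..<n} \<times> {..<n}) \<inter> oriented_edges C = oriented_edges C"
      and "I ({..<n} \<times> {..<n}) s'"
    then obtain es where es: "distinct es" "set es = oriented_edges C" "out s' = out ?s @ ?code es"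
      by (auto simp: I_def)
    \<comment> \<open>The size written before this scan was counted by the previous one.\<close>
    have "length es = reg s 16" using distinct_card[OF es(1)] es(2) m by (simp add: C_def)
    then have "out s' = out s @ edge_code es" using es(3) by (simp add: edge_code_def)
    then show "\<exists>es. distinct es \<and> set es = oriented_edges C \<and> out s' = out s @ edge_code es"
      using es by blast
  qed simp
  have 7: "reg s 7 = 1" using s(1) by (simp add: static_def ready_def)
  have "runs emit s (1 + (scan_time n 10 + 1)) (\<lambda>s'. if reg s 15 = 1 then out s' = out s else
    \<exists>es. distinct es \<and> set es = oriented_edges C \<and> out s' = out s @ edge_code es)"
    unfolding emit_def
  proof (rule runs_Cond)
    assume "holds (Equal 15 7) s"
    then show "runs Skip s (scan_time n 10 + 1) (\<lambda>s'. if reg s 15 = 1 then out s' = out s else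
      \<exists>es. distinct es \<and> set es = oriented_edges C \<and> out s' = out s @ edge_code es)"
      using 7 by (intro runs_loop_free) simp_all
  next
    assume "\<not> holds (Equal 15 7) s"
    then show "runs (Seq (Out 16) (Scan emit_entry)) s (scan_time n 10 + 1) (\<lambda>s'.
      if reg s 15 = 1 then out s' = out s else
      \<exists>es. distinct es \<and> set es = oriented_edges C \<and> out s' = out s @ edge_code es)"
      using 1 7 by simp
  qed
  then show ?thesis unfolding C_def by (rule runs_mono) (simp_all add: emit_time_def)
qed

lemma runs_advance:
  assumes s: "static s" "bits X s" "candidate X n s"
  shows "runs advance s (n * 4 + 5) (\<lambda>s'.
    if reg s 17 = 0 then reg s' 14 = 1 \<and> bits X s'
    else reg s' 14 = reg s 14 \<and> bits (insert (reg s 18) (X \<inter> {..<reg s 18})) s')"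
proof -
  let ?b = "Cond (Less 18 12) (Write 7 12 8) Skip" and ?i = "reg s 18"
  let ?Q = "\<lambda>s'. if reg s 17 = 0 then reg s' 14 = 1 \<and> bits X s'
    else reg s' 14 = reg s 14 \<and> bits (insert ?i (X \<inter> {..<?i})) s'"
  have n: "reg s 0 = n" and cs: "reg s 7 = 1" "reg s 8 = 0"
    using s(1) by (simp_all add: static_def ready_def)
  define I where "I k s' \<longleftrightarrow> (\<forall>j<n. arr s' 7 j = of_bool (j \<in> X \<and> (j < k \<longrightarrow> j \<le> ?i)))"
    for k and s' :: state
  have "runs (For 12 ?b) s (reg s 0 * (2 + 2) + 2) (\<lambda>s'. I (reg s 0) s')"
  proof (rule runs_For)
    show "I 0 (set_reg 12 0 s)" using s(2) by (simp add: I_def bits_def)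
  next
    fix k s' assume a: "agree (insert 12 (wregs ?b)) (warrs ?b) (silent ?b) s s'"
      and k: "reg s' 12 = k" and I: "I k s'"
    have "reg s' 8 = 0" "reg s' 18 = ?i"
      using agree_reg[OF a, of 8] agree_reg[OF a, of 18] cs by simp_all
    then have "I (Suc k) (set_reg 12 (Suc k) (result ?b s'))"
      using I k by (auto simp: I_def less_Suc_eq)
    then show "runs ?b s' 2 (\<lambda>s''. I (Suc k) (set_reg 12 (Suc k) s''))"
      by (rule runs_loop_free[rotated]) simp_all
  qed simp_all
  from runs_frame[OF this] have loop: "runs (For 12 ?b) s (n * 4 + 2) (\<lambda>s'. frame (For 12 ?b) s s' \<and> I n s')"
    unfolding n by simp
  have "runs advance s (1 + (n * 4 + 3)) ?Q"
    unfolding advance_def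
  proof (rule runs_Cond)
    assume "holds (Equal 17 7) s"
    then have 17: "reg s 17 = 1" using cs by simp
    then have i: "?i < n" "?i \<notin> X" using s(3) by (auto simp: candidate_def addable_def)
    have "runs (For 12 ?b) s (n * 4 + 2) (\<lambda>s'. runs (Write 7 18 7) s' 1 ?Q)"
      using loop
    proof (rule runs_mono)
      fix s' assume *: "frame (For 12 ?b) s s' \<and> I n s'"
      then have f: "frame (For 12 ?b) s s'" by blast
      have r: "reg s' 18 = ?i" "reg s' 7 = 1" "reg s' 14 = reg s 14"
        using agree_reg[OF f, of 18] agree_reg[OF f, of 7] agree_reg[OF f, of 14] cs by simp_all
      have "bits (insert ?i (X \<inter> {..<?i})) (result (Write 7 18 7) s')"
        using * i r by (auto simp: I_def bits_def)
      then have "?Q (result (Write 7 18 7) s')" using r 17 by simp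
      then show "runs (Write 7 18 7) s' 1 ?Q" by (rule runs_loop_free[rotated]) simp_all
    qed simp
    from runs_Seq[OF this] show "runs (Seq (For 12 ?b) (Write 7 18 7)) s (n * 4 + 3) ?Q"
      by (rule runs_mono) simp_all
  next
    assume "\<not> holds (Equal 17 7) s"
    then have "reg s 17 = 0" using cs s(3) by (auto simp: candidate_def)
    then have "?Q (result (Move 14 7) s)" using s(2) cs by (simp add: bits_def)
    then show "runs (Move 14 7) s (n * 4 + 3) ?Q" by (rule runs_loop_free[rotated]) simp_all
  qed
  then show ?thesis by (rule runs_mono) simp_all
qed

end

lemma runs_Seq_mono:
  assumes "runs c s t P" "\<And>s'. P s' \<Longrightarrow> runs d s' u Q"
  shows "runs (Seq c d) s (t + u) Q"
  by (rule runs_Seq, rule runs_mono[OF assms(1) order_refl]) (rule assms(2))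

definition process_time :: "nat \<Rightarrow> nat" where
  "process_time n = (n * 5 + 5) + ((n * 18 + 2) + (scan_time n 15 + (5 + (emit_time n + (n * 4 + 5)))))"

context enumeration
begin

definition outputs :: "nat set set \<Rightarrow> state \<Rightarrow> state \<Rightarrow> bool" where
  "outputs C s s' \<longleftrightarrow> (if C \<in> matching_cuts {..<n} E
     then \<exists>es. distinct es \<and> set es = oriented_edges C \<and> out s' = out s @ edge_code es
     else out s' = out s)"

definition advanced :: "nat set \<Rightarrow> state \<Rightarrow> bool" where
  "advanced X s' \<longleftrightarrow> (reg s' 14 = 1 \<and> bits X s' \<and> (\<forall>i<n. \<not> addable par X i)) \<or>
     (reg s' 14 = 0 \<and> (\<exists>i<n. addable par X i \<and> (\<forall>j. i < j \<longrightarrow> j < n \<longrightarrow> \<not> addable par X j) \<and>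
        bits (insert i (X \<inter> {..<i})) s'))"

text \<open>The witness \<open>A\<close> is the colour class computed from \<open>X\<close>. Frame
  facts carry what later phases need across each intermediate state.\<close>

lemma runs_process_matching:
  assumes s: "static s" "bits X s" "reg s 14 = 0" and X: "X \<in> forest_matchings par {..<n}"
  shows "runs process_matching s (process_time n) (\<lambda>s'. static s' \<and> advanced X s' \<and>
    (\<exists>A\<subseteq>{..<n}. forest_part (edges_between E A ({..<n} - A)) = X \<and>
      outputs (edges_between E A ({..<n} - A)) s s'))"
    (is "runs _ _ _ ?Q")
  unfolding process_matching_def process_time_def
proof (rule runs_Seq_mono, rule runs_frame, rule runs_clear[OF s(1)])
  fix s1 :: state
  assume "frame clear s s1 \<and> (\<forall>v<n. arr s1 4 v = 0 \<and> arr s1 5 v = 0 \<and> arr s1 6 v = 0) \<and>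
    reg s1 15 = 0 \<and> reg s1 16 = 0 \<and> reg s1 17 = 0"
  then have f1: "frame clear s s1"
    and zero: "\<And>v. v < n \<Longrightarrow> arr s1 4 v = 0" "\<And>v. v < n \<Longrightarrow> arr s1 5 v = 0" "\<And>v. v < n \<Longrightarrow> arr s1 6 v = 0"
      "reg s1 15 = 0" "reg s1 16 = 0" "reg s1 17 = 0" by auto
  have st1: "static s1" by (rule static_agree[OF f1 s(1)]) (simp_all add: program_defs)
  have k1: "reg s1 14 = 0" "arr s1 7 = arr s 7" "out s1 = out s"
    using agree_reg[OF f1, of 14] agree_arr[OF f1, of 7] agree_out[OF f1] s
    by (simp_all add: program_defs)
  then have b1: "bits X s1" using s(2) by (simp add: bits_def)
  show "runs (Seq (For 12 colour_next) (Seq (Scan check_entry) (Seq check_empty (Seq emit advance)))) s1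
    ((n * 18 + 2) + (scan_time n 15 + (5 + (emit_time n + (n * 4 + 5))))) ?Q"
  proof (rule runs_Seq_mono, rule runs_frame, rule runs_colour[OF st1 b1 X zero(1,3,6)])
    fix s2 :: state
    let ?c = "arr s2 4"
    assume "frame (For 12 colour_next) s1 s2 \<and> binary ?c \<and>
      (\<forall>i<n. ?c (ord i) \<noteq> ?c (ord (par i)) \<longleftrightarrow> i \<in> X) \<and> candidate X n s2"
    then have f2: "frame (For 12 colour_next) s1 s2" and bin: "binary ?c" and cand: "candidate X n s2"
      and col: "\<And>i. i < n \<Longrightarrow> ?c (ord i) \<noteq> ?c (ord (par i)) \<longleftrightarrow> i \<in> X" by auto
    have st2: "static s2" by (rule static_agree[OF f2 st1]) (simp_all add: program_defs)
    have k2: "reg s2 14 = 0" "reg s2 15 = 0" "reg s2 16 = 0" "arr s2 7 = arr s 7" "arr s2 5 = arr s1 5"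
      "out s2 = out s"
      using agree_reg[OF f2, of 14] agree_reg[OF f2, of 15] agree_reg[OF f2, of 16]
        agree_arr[OF f2, of 7] agree_arr[OF f2, of 5] agree_out[OF f2] k1 zero
      by (simp_all add: program_defs)
    define C where "C = cut_of ?c"
    have fp: "forest_part C = X"
      using col X unfolding C_def forest_part_cut_of[OF bin] by (auto simp: forest_matchings_def)
    show "runs (Seq (Scan check_entry) (Seq check_empty (Seq emit advance))) s2
      (scan_time n 15 + (5 + (emit_time n + (n * 4 + 5)))) ?Q"
    proof (rule runs_Seq_mono, rule runs_frame, rule runs_check[OF st2 bin])
      show "\<And>v. v < n \<Longrightarrow> arr s2 5 v = 0" "reg s2 15 = 0" "reg s2 16 = 0"
        using k2 zero by simp_all
      fix s3 :: state
      assume "frame (Scan check_entry) s2 s3 \<and> reg s3 15 = of_bool (\<not> matching E (cut_of ?c)) \<and>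
        reg s3 16 = card (oriented_edges (cut_of ?c))"
      then have f3: "frame (Scan check_entry) s2 s3"
        and r3: "reg s3 15 = of_bool (\<not> matching E (cut_of ?c))"
          "reg s3 16 = card (oriented_edges (cut_of ?c))" by auto
      have st3: "static s3" by (rule static_agree[OF f3 st2]) (simp_all add: program_defs)
      have k3: "reg s3 14 = 0" "reg s3 17 = reg s2 17" "reg s3 18 = reg s2 18" "arr s3 7 = arr s 7"
        "arr s3 4 = ?c" "out s3 = out s"
        using agree_reg[OF f3, of 14] agree_reg[OF f3, of 17] agree_reg[OF f3, of 18]
          agree_arr[OF f3, of 7] agree_arr[OF f3, of 4] agree_out[OF f3] k2
        by (simp_all add: program_defs)
      have bin3: "binary (arr s3 4)" using bin k3 by simp
      show "runs (Seq check_empty (Seq emit advance)) s3 (5 + (emit_time n + (n * 4 + 5))) ?Q"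
      proof (rule runs_Seq_mono, rule runs_frame, rule runs_check_empty[OF st3 bin3])
        show "reg s3 15 = of_bool (\<not> matching E (cut_of (arr s3 4)))"
          "reg s3 16 = card (oriented_edges (cut_of (arr s3 4)))" using r3 k3 by simp_all
        fix s4 :: state
        assume "frame check_empty s3 s4 \<and> reg s4 15 = of_bool (cut_of (arr s3 4) \<notin> matching_cuts {..<n} E)"
        then have f4: "frame check_empty s3 s4"
          and r4: "reg s4 15 = of_bool (C \<notin> matching_cuts {..<n} E)" using k3 C_def by auto
        have st4: "static s4" by (rule static_agree[OF f4 st3]) (simp_all add: program_defs)
        have k4: "reg s4 14 = 0" "reg s4 17 = reg s2 17" "reg s4 18 = reg s2 18" "arr s4 7 = arr s 7"
          "arr s4 4 = ?c" "out s4 = out s" "reg s4 16 = reg s3 16"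
          using agree_reg[OF f4, of 14] agree_reg[OF f4, of 17] agree_reg[OF f4, of 18]
            agree_reg[OF f4, of 16] agree_arr[OF f4, of 7] agree_arr[OF f4, of 4] agree_out[OF f4] k3
          by (simp_all add: program_defs)
        have bin4: "binary (arr s4 4)" using bin k4 by simp
        show "runs (Seq emit advance) s4 (emit_time n + (n * 4 + 5)) ?Q"
        proof (rule runs_Seq_mono, rule runs_frame, rule runs_emit[OF st4 bin4])
          show "reg s4 16 = card (oriented_edges (cut_of (arr s4 4)))" using k4 r3 by simp
          fix s5 :: state
          assume "frame emit s4 s5 \<and> (if reg s4 15 = 1 then out s5 = out s4 else
            \<exists>es. distinct es \<and> set es = oriented_edges (cut_of (arr s4 4)) \<and> out s5 = out s4 @ edge_code es)"
          then have f5: "frame emit s4 s5" and o5: "outputs C s s5"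
            using r4 k4 by (auto simp: outputs_def C_def split: if_splits)
          have st5: "static s5" by (rule static_agree[OF f5 st4]) (simp_all add: program_defs)
          have k5: "reg s5 14 = 0" "reg s5 17 = reg s2 17" "reg s5 18 = reg s2 18" "arr s5 7 = arr s 7"
            using agree_reg[OF f5, of 14] agree_reg[OF f5, of 17] agree_reg[OF f5, of 18]
              agree_arr[OF f5, of 7] k4
            by (simp_all add: program_defs)
          have b5: "bits X s5" and c5: "candidate X n s5"
            using s(2) cand k5 by (simp_all add: bits_def candidate_def)
          show "runs advance s5 (n * 4 + 5) ?Q"
          proof (rule runs_mono[OF runs_frame[OF runs_advance[OF st5 b5 c5]] order_refl])
            fix s' :: state
            assume *: "frame advance s5 s' \<and> (if reg s5 17 = 0 then reg s' 14 = 1 \<and> bits X s'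
              else reg s' 14 = reg s5 14 \<and> bits (insert (reg s5 18) (X \<inter> {..<reg s5 18})) s')"
            then have f: "frame advance s5 s'" by blast
            have "static s'" by (rule static_agree[OF f st5]) (simp_all add: program_defs)
            moreover have "advanced X s'"
            proof (cases "reg s5 17 = 0")
              case True
              then show ?thesis using * c5 by (auto simp: advanced_def candidate_def)
            next
              case False
              then have "reg s' 14 = 0" "bits (insert (reg s5 18) (X \<inter> {..<reg s5 18})) s'"
                using * k5 by simp_all
              moreover have "reg s5 18 < n" "addable par X (reg s5 18)"
                "\<forall>j. reg s5 18 < j \<longrightarrow> j < n \<longrightarrow> \<not> addable par X j"
                using c5 False by (auto simp: candidate_def)
              ultimately show ?thesis unfolding advanced_def by blast
            qed
            moreover have "outputs C s s'"
              using o5 agree_out[OF f] by (simp add: outputs_def program_defs)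
            ultimately show "?Q s'"
              using fp colour_class_subset unfolding C_def cut_of_def by blast
          qed
        qed
      qed
    qed
  qed
qed

section \<open>Correctness and number of rounds of the main loop\<close>

definition invariant :: "state \<Rightarrow> bool" where
  "invariant s \<longleftrightarrow> static s \<and> (\<exists>X\<in>forest_matchings par {..<n}. bits X s \<and>
     (reg s 14 = 0 \<and> lists_exactly (out s) {M \<in> matching_cuts {..<n} E. lex_less (forest_part M) X} \<or>
      reg s 14 = 1 \<and> lists_exactly (out s) (matching_cuts {..<n} E)))"

text \<open>The current matching is counted too, so the measure stays positive until the finishing
  flag is set and is at most the number of forest matchings at the start. The matching is read from
  array 7 to make this a function of the state.\<close>

definition remaining :: "state \<Rightarrow> nat" where
  "remaining s = (if reg s 14 = 0 then card {Z \<in> forest_matchings par {..<n}.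
     \<not> lex_less Z {j. j < n \<and> arr s 7 j = 1}} else 0)"

lemma bits_set: "bits X s \<Longrightarrow> X \<in> forest_matchings par {..<n} \<Longrightarrow> {j. j < n \<and> arr s 7 j = 1} = X"
  by (auto simp: bits_def forest_matchings_def of_bool_def split: if_splits)

lemma finite_fm: "finite {Z \<in> forest_matchings par {..<n}. P Z}"
  by (simp add: finite_forest_matchings)

text \<open>Only \<open>C\<close> can be a matching cut with trace \<open>X\<close>. So after the
  round the output covers exactly the traces up to \<open>X\<close>, whether or not \<open>C\<close>
  was written; these are all traces if nothing is addable, and otherwise those below the successor
  of \<open>X\<close>.\<close>

lemma invariant_step:
  assumes s: "bits X s" "reg s 14 = 0" and X: "X \<in> forest_matchings par {..<n}"
    and l: "lists_exactly (out s) {M \<in> matching_cuts {..<n} E. lex_less (forest_part M) X}"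
    and s': "static s'" "advanced X s'" and A: "A \<subseteq> {..<n}"
    and C: "C = edges_between E A ({..<n} - A)" "forest_part C = X" "outputs C s s'"
  shows "invariant s' \<and> remaining s' < remaining s"
proof -
  let ?F = "forest_matchings par {..<n}" and ?mc = "matching_cuts {..<n} E"
  have uniq: "M = C" if "M \<in> ?mc" "forest_part M = X" for M
    using forest_part_eq_imp_eq[of M A] matching_cuts_subset that C A by auto
  have CE: "C \<subseteq> E" unfolding C(1) by (rule edges_between_subset)
  have l': "lists_exactly (out s') {M \<in> ?mc. lex_less (forest_part M) X \<or> forest_part M = X}"
  proof (cases "C \<in> ?mc")
    case True
    then obtain es where es: "distinct es" "set es = oriented_edges C" "out s' = out s @ edge_code es"
      using C(3) by (auto simp: outputs_def)
    have "{M \<in> ?mc. lex_less (forest_part M) X \<or> forest_part M = X} =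
        insert C {M \<in> ?mc. lex_less (forest_part M) X}"
      using True uniq C(2) by blast
    moreover have "C \<notin> {M \<in> ?mc. lex_less (forest_part M) X}" using C(2) lex_less_irrefl by blast
    ultimately show ?thesis using lists_exactly_append[OF l es(1,2) _ simple CE] es(3) by simp
  next
    case False
    then have "{M \<in> ?mc. lex_less (forest_part M) X \<or> forest_part M = X} =
        {M \<in> ?mc. lex_less (forest_part M) X}"
      using uniq by blast
    then show ?thesis using False C(3) l by (simp add: outputs_def)
  qed
  have fm: "forest_part M \<in> ?F" if "M \<in> ?mc" for M
    using that forest_part_in matching_cuts_subset by blast
  have rem: "remaining s = card {Z \<in> ?F. \<not> lex_less Z X}"
    using s bits_set[OF s(1) X] by (simp add: remaining_def)
  have X_rem: "X \<in> {Z \<in> ?F. \<not> lex_less Z X}" using X lex_less_irrefl by blast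
  from s'(2) consider (finished) "reg s' 14 = 1" "bits X s'" "\<And>i. i < n \<Longrightarrow> \<not> addable par X i"
    | (next_one) i where "reg s' 14 = 0" "i < n" "addable par X i"
      "\<And>j. i < j \<Longrightarrow> j < n \<Longrightarrow> \<not> addable par X j" "bits (insert i (X \<inter> {..<i})) s'"
    unfolding advanced_def by blast
  then show ?thesis
  proof cases
    case finished
    have "{M \<in> ?mc. lex_less (forest_part M) X \<or> forest_part M = X} = ?mc"
      using lex_less_last[OF finished(3)] fm by blast
    then have "invariant s'" using l' s'(1) finished(1,2) X unfolding invariant_def by auto
    moreover have "card {Z \<in> ?F. \<not> lex_less Z X} > 0"
      using X_rem finite_fm by (auto simp: card_gt_0_iff)
    then have "remaining s' < remaining s" unfolding rem using finished(1) by (simp add: remaining_def)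
    ultimately show ?thesis ..
  next
    case next_one
    let ?Y = "insert i (X \<inter> {..<i})"
    have Y: "?Y \<in> ?F" by (rule addable_in_forest_matchings[OF X next_one(3,2)])
    note iff = lex_less_addable_iff[OF X next_one(3,4)]
    have "{M \<in> ?mc. lex_less (forest_part M) X \<or> forest_part M = X} =
        {M \<in> ?mc. lex_less (forest_part M) ?Y}"
      using iff fm by blast
    then have "invariant s'" using l' s'(1) next_one(1,5) Y unfolding invariant_def by auto
    moreover have "remaining s' < remaining s"
    proof -
      have "{Z \<in> ?F. \<not> lex_less Z ?Y} = {Z \<in> ?F. \<not> lex_less Z X} - {X}" using iff by blast
      moreover have "remaining s' = card {Z \<in> ?F. \<not> lex_less Z ?Y}"
        using next_one(1) bits_set[OF next_one(5) Y] by (simp add: remaining_def)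
      ultimately show ?thesis using card_Diff1_less[OF finite_fm X_rem] rem by simp
    qed
    ultimately show ?thesis ..
  qed
qed

lemma runs_enumeration:
  assumes s: "static s" "bits {} s" "reg s 14 = 0" "out s = []"
  shows "runs (While (Equal 14 8) process_matching) s (fib (n + 1) * (process_time n + 1) + 1)
    (\<lambda>s'. lists_exactly (out s') (matching_cuts {..<n} E))"
proof -
  have empty: "{} \<in> forest_matchings par {..<n}" by (simp add: forest_matchings_def)
  have "runs (While (Equal 14 8) process_matching) s (fib (n + 1) * (process_time n + 1) + 1)
    (\<lambda>s'. invariant s' \<and> \<not> holds (Equal 14 8) s')"
  proof (rule runs_While)
    have "\<not> lex_less Z {}" for Z by (simp add: lex_less_def)
    then have "lists_exactly (out s) {M \<in> matching_cuts {..<n} E. lex_less (forest_part M) {}}"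
      using s(4) lists_exactly_Nil by simp
    then show "invariant s" using s empty unfolding invariant_def by blast
    have "remaining s \<le> card (forest_matchings par {..<n})"
      unfolding remaining_def by (auto intro!: card_mono simp: finite_forest_matchings)
    also have "\<dots> \<le> fib (n + 1)" using card_forest_matchings_le[of "{..<n}" par] by simp
    finally show "remaining s \<le> fib (n + 1)" .
  next
    fix s assume inv: "invariant s" and "holds (Equal 14 8) s"
    then have 14: "reg s 14 = 0" by (auto simp: invariant_def static_def ready_def)
    then obtain X where X: "X \<in> forest_matchings par {..<n}" "bits X s" "static s"
        "lists_exactly (out s) {M \<in> matching_cuts {..<n} E. lex_less (forest_part M) X}"
      using inv unfolding invariant_def by auto
    show "runs process_matching s (process_time n) (\<lambda>s'. invariant s' \<and> remaining s' < remaining s)"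
    proof (rule runs_mono[OF runs_process_matching[OF X(3,2) 14 X(1)] order_refl])
      fix s' :: state
      assume "static s' \<and> advanced X s' \<and> (\<exists>A\<subseteq>{..<n}.
        forest_part (edges_between E A ({..<n} - A)) = X \<and> outputs (edges_between E A ({..<n} - A)) s s')"
      then show "invariant s' \<and> remaining s' < remaining s"
        using invariant_step[OF X(2) 14 X(1,4)] by blast
    qed
  qed
  then show ?thesis
  proof (rule runs_mono)
    fix s' assume *: "invariant s' \<and> \<not> holds (Equal 14 8) s'"
    then have "reg s' 14 \<noteq> 0" by (simp add: invariant_def static_def ready_def)
    then show "lists_exactly (out s') (matching_cuts {..<n} E)"
      using * unfolding invariant_def by auto
  qed simp
qed

end

section \<open>Total running time\<close>

definition total_time :: "nat \<Rightarrow> nat" where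
  "total_time n = order_time n + (fib (n + 1) * (process_time n + 1) + 1)"

lemma runs_enumerate_cuts:
  assumes g: "simple_graph {..<n} E"
  shows "runs enumerate_cuts (input_state n E) (total_time n)
    (\<lambda>s. lists_exactly (out s) (matching_cuts {..<n} E))"
  unfolding enumerate_cuts_def total_time_def
proof (rule runs_Seq_mono, rule runs_frame, rule runs_compute_order)
  let ?s = "input_state n E"
  have index: "u * n + w < n * n \<and> (u * n + w) div n = u \<and> (u * n + w) mod n = w"
    if "u < n" "w < n" for u w
  proof -
    have "u * n + w < Suc u * n" using that by simp
    also have "\<dots> \<le> n * n" using that by (intro mult_le_mono1) simp
    finally show ?thesis using that by simp
  qed
  then show r: "ready n E (set_reg 7 1 ?s)" by (simp add: ready_def input_state_def)
  show "reg ?s 13 = 0" "\<And>v. arr ?s 1 v = 0" by (simp_all add: input_state_def)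
  fix s assume *: "frame compute_order ?s s \<and> ready n E s \<and> (\<exists>par. ordered_state n E n par s)"
  then have f: "frame compute_order ?s s" by blast
  obtain par where o: "ordered_state n E n par s" using * by blast
  interpret enumeration n E "arr s 2" par
    by unfold_locales (use g o in \<open>simp_all add: ordered_state_def\<close>)
  show "runs (While (Equal 14 8) process_matching) s (fib (n + 1) * (process_time n + 1) + 1)
    (\<lambda>s. lists_exactly (out s) (matching_cuts {..<n} E))"
  proof (rule runs_enumeration)
    show "static s" using * o by (simp add: static_def ordered_state_def)
    have "arr s 7 = arr ?s 7" using agree_arr[OF f, of 7] by (simp add: compute_order_def program_defs)
    then show "bits {} s" by (simp add: bits_def input_state_def)
    show "reg s 14 = 0" "out s = []"
      using agree_reg[OF f, of 14] agree_out[OF f]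
      by (simp_all add: compute_order_def program_defs input_state_def)
  qed
qed

text \<open>Converts the bound \<open>fib (n + 1)\<close> on the rounds into the required
  \<open>fib n\<close>; at \<open>n = 0\<close> it fails, as \<open>fib 0 = 0\<close>.\<close>

lemma fib_Suc_le: "n \<ge> 1 \<Longrightarrow> fib (n + 1) \<le> 2 * fib n"
  using fib_mono[of "n - 1" n] by (cases n) (auto simp: numeral_2_eq_2)

lemma total_time_le:
  assumes n: "n \<ge> 1"
  shows "total_time n \<le> 240 * (n ^ 3 * fib n)"
proof -
  have 1: "n \<le> n ^ 2" "1 \<le> n ^ 2" "n ^ 2 \<le> n ^ 3" "n \<le> n ^ 3" "1 \<le> n ^ 3"
    using n self_le_power[of n 2] self_le_power[of n 3] power_increasing[of 2 3 n] by simp_all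
  have "process_time n + 1 = 33 * n ^ 2 + 35 * n + 29"
    by (simp add: process_time_def emit_time_def scan_time_def power2_eq_square algebra_simps)
  also have "\<dots> \<le> 97 * n ^ 3" using 1 by linarith
  finally have p: "process_time n + 1 \<le> 97 * n ^ 3" .
  have "order_time n = 14 * n ^ 3 + 4 * n ^ 2 + 16 * n + 3"
    by (simp add: order_time_def scan_time_def power2_eq_square power3_eq_cube algebra_simps)
  also have "\<dots> \<le> 37 * n ^ 3" using 1 by linarith
  finally have o: "order_time n \<le> 37 * n ^ 3" .
  have "fib (n + 1) * (process_time n + 1) \<le> (2 * fib n) * (97 * n ^ 3)"
    using fib_Suc_le[OF n] p by (intro mult_le_mono)
  also have "\<dots> = 194 * (n ^ 3 * fib n)" by simp
  finally have "fib (n + 1) * (process_time n + 1) \<le> 194 * (n ^ 3 * fib n)" .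
  moreover have "1 \<le> fib n" using n fib_neq_0_nat[of n] by simp
  then have "n ^ 3 \<le> n ^ 3 * fib n" using mult_le_mono2[of 1 "fib n" "n ^ 3"] by simp
  \<comment> \<open>The constants 97 and 37 are sums of polynomial coefficients; 37 + 194 + 1 = 232
    is rounded up to 240.\<close>
  ultimately show ?thesis unfolding total_time_def using o 1 by linarith
qed

lemma total_time_O_star: "(\<lambda>n. real (total_time n)) \<in> O_star (\<lambda>n. real (fib n))"
proof -
  have "(\<lambda>n. real (total_time n)) \<in> O(\<lambda>n. real n ^ 3 * real (fib n))"
  proof (rule bigoI[of _ 240])
    have "real (total_time n) \<le> 240 * (real n ^ 3 * real (fib n))" if "n \<ge> 1" for n
      using total_time_le[OF that] by (metis of_nat_le_iff of_nat_mult of_nat_numeral of_nat_power)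
    then show "\<forall>\<^sub>F n in sequentially. norm (real (total_time n)) \<le> 240 * norm (real n ^ 3 * real (fib n))"
      unfolding eventually_sequentially by (intro exI[of _ 1]) simp
  qed
  then show ?thesis unfolding O_star_def by blast
qed

lemma enumerates_enumerate_cuts: "enumerates_matching_cuts_in_time enumerate_cuts total_time"
  using runs_enumerate_cuts unfolding enumerates_matching_cuts_in_time_def runs_def by blast

theorem theorem10:
  "(\<forall>(V :: 'a set) E. simple_graph V E \<longrightarrow>
      card (matching_cuts V E) \<le> fib (card V + 1) - 1) \<and>
   (\<forall>n\<ge>1. card (matching_cuts {..<n} (path_edges n)) = fib (n + 1) - 1) \<and>
   (\<forall>(V :: 'a set) E. simple_graph V E \<and> card V \<ge> 5 \<longrightarrow>
      (card (matching_cuts V E) = fib (card V + 1) - 1 \<longleftrightarrow> is_path V E)) \<and>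
   (\<exists>P T. enumerates_matching_cuts_in_time P T \<and>
      (\<lambda>n. real (T n)) \<in> O_star (\<lambda>n. real (fib n)))"
proof (intro conjI allI impI)
  fix V :: "'a set" and E
  assume "simple_graph V E"
  then obtain ord par where "search_ordered V E (card V) ord par" by (rule search_orderedE)
  then show "card (matching_cuts V E) \<le> fib (card V + 1) - 1"
    by (rule search_ordered.card_matching_cuts_le)
next
  fix V :: "'a set" and E
  assume "simple_graph V E \<and> card V \<ge> 5"
  then show "card (matching_cuts V E) = fib (card V + 1) - 1 \<longleftrightarrow> is_path V E"
    using is_path_if_card_eq card_eq_if_is_path by blast
next
  show "\<exists>P T. enumerates_matching_cuts_in_time P T \<and> (\<lambda>n. real (T n)) \<in> O_star (\<lambda>n. real (fib n))"
    using enumerates_enumerate_cuts total_time_O_star by blast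
qed (rule card_matching_cuts_path_edges)

end
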